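(* Let $d\ge1$ and $l\in S^{d-1}$. If for some $\delta>0$ and all $\omega\in\Omega$, all $x\in\mathbb R^d$, $b(x,\omega)\cdot l>\delta$, then condition $(T)|l$ holds.
   Context: Setting. $(\Omega,\mathcal A,\mathbb P)$ is a probability space with a group $\{t_x:x\in\mathbb R^d\}$ of transformations of $\Omega$, jointly measurable in $x,\omega$, preserving $\mathbb P$. $b:\Omega\to\mathbb R^d$, $\sigma:\Omega\to\mathbb R^{d\times d}$ are measurable with $|b|\le\bar b$, $|\sigma|\le\bar\sigma$ for finite constants $\bar b,\bar\sigma>0$; $b(x,\omega)=b(t_x\omega)$, $\sigma(x,\omega)=\sigma(t_x\omega)$. There are $K>0$, $\nu>0$, $R>0$ such that for all $\omega,x,y$: $|b(x,\omega)-b(y,\omega)|+|\sigma(x,\omega)-\sigma(y,\omega)|\le K|x-y|$; $\frac1\nu|y|^2\le|\sigma^t(x,\omega)y|^2\le\nu|y|^2$ ($\sigma^t$ the transpose); and, with $\mathcal H_F=\sigma\{b(x,\cdot),\sigma(x,\cdot):x\in F\}$, the $\sigma$-fields $\mathcal H_F,\mathcal H_{F'}$ are $\mathbb P$-independent for all Borel $F,F'\subset\mathbb R^d$ at distance $>R$. $P_{x,\omega}$ (quenched law) is the law on $C(\mathbb R_+,\mathbb R^d)$, with canonical process $(X_t)$, of the solution of $dX_t=\sigma(X_t,\omega)dB_t+b(X_t,\omega)dt$, $X_0=x$. The annealed law is $P_x=\mathbb P\times P_{x,\omega}$. Condition $(T)|l$. $T_U=\inf\{t\ge0:X_t\notin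 U\}$; for a unit vector $l$ and $b,L>0$, $U_{l,b,L}=\{x\in\mathbb R^d:-bL<x\cdot l<L\}$. $(T)|l$ means: for all $l'\in S^{d-1}$ in some neighborhood of $l$ and all $b>0$, $\limsup_{L\to\infty}L^{-1}\log P_0[X_{T_{U_{l',b,L}}}\cdot l'<0]<0$. *)

theory Defs
  imports "HOL-Probability.Probability"
begin

section \<open>Ito integration and stochastic differential equations\<close>

text \<open>
  Time is the set of nonnegative reals, rendered as the subset \<open>{0..}\<close> of the type \<open>real\<close>.
  Filtrations are those of the library, indexed by all of \<open>real\<close>; their members at negative times
  play no role.
\<close>

definition brownian_motion ::
    "'s measure \<Rightarrow> (real \<Rightarrow> 's measure) \<Rightarrow> (real \<Rightarrow> 's \<Rightarrow> real ^ 'n) \<Rightarrow> bool" where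
  "brownian_motion M F B \<longleftrightarrow>
     (\<forall>w\<in>space M. B 0 w = 0 \<and> continuous_on {0..} (\<lambda>t. B t w)) \<and>
     (\<forall>t\<ge>0. B t \<in> borel_measurable (F t)) \<and>
     (\<forall>s t. 0 \<le> s \<and> s < t \<longrightarrow>
        prob_space.indep_set M (sets (F s))
          {(\<lambda>w. B t w - B s w) -` A \<inter> space M | A. A \<in> sets borel} \<and>
        distributed M lborel (\<lambda>w. B t w - B s w)
          (\<lambda>y. ennreal (\<Prod>i\<in>UNIV. normal_density 0 (sqrt (t - s)) (y $ i))))"

text \<open>
  A simple integrand is given by a grid \<open>\<tau> 0 < \<dots> < \<tau> n\<close> and random matrices \<open>\<xi> 0, \<dots>, \<xi> (n - 1)\<close>,
  \<open>\<xi> i\<close> being the value on the interval from \<open>\<tau> i\<close> (excluded) to \<open>\<tau> (Suc i)\<close> (included).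
\<close>

definition simple_integrand ::
    "(real \<Rightarrow> 's measure) \<Rightarrow> nat \<Rightarrow> (nat \<Rightarrow> real) \<Rightarrow> (nat \<Rightarrow> 's \<Rightarrow> real ^ 'n ^ 'n) \<Rightarrow> bool" where
  "simple_integrand F n \<tau> \<xi> \<longleftrightarrow>
     0 \<le> \<tau> 0 \<and> (\<forall>i<n. \<tau> i < \<tau> (Suc i)) \<and>
     (\<forall>i<n. \<xi> i \<in> borel_measurable (F (\<tau> i)) \<and> bounded (\<xi> i ` space (F (\<tau> i))))"

definition simple_process ::
    "nat \<Rightarrow> (nat \<Rightarrow> real) \<Rightarrow> (nat \<Rightarrow> 's \<Rightarrow> real ^ 'n ^ 'n) \<Rightarrow> real \<Rightarrow> 's \<Rightarrow> real ^ 'n ^ 'n" where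
  "simple_process n \<tau> \<xi> s w = (\<Sum>i<n. indicator {\<tau> i<..\<tau> (Suc i)} s *\<^sub>R \<xi> i w)"

definition simple_integral ::
    "(real \<Rightarrow> 's \<Rightarrow> real ^ 'n) \<Rightarrow> nat \<Rightarrow> (nat \<Rightarrow> real) \<Rightarrow> (nat \<Rightarrow> 's \<Rightarrow> real ^ 'n ^ 'n)
      \<Rightarrow> real \<Rightarrow> 's \<Rightarrow> real ^ 'n" where
  "simple_integral B n \<tau> \<xi> T w =
     (\<Sum>i<n. \<xi> i w *v (B (min (\<tau> (Suc i)) T) w - B (min (\<tau> i) T) w))"

text \<open>
  \<open>has_ito_integral M F B H T J\<close>: the random vector \<open>J\<close> is (a version of) the Ito integral of \<open>H\<close>
  against the Brownian motion \<open>B\<close> over \<open>{0..T}\<close>, that is, the limit in \<open>L\<^sup>2\<close> of the integrals of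
  simple integrands that converge to \<open>H\<close> in \<open>L\<^sup>2\<close>.
\<close>

definition has_ito_integral ::
    "'s measure \<Rightarrow> (real \<Rightarrow> 's measure) \<Rightarrow> (real \<Rightarrow> 's \<Rightarrow> real ^ 'n) \<Rightarrow>
     (real \<Rightarrow> 's \<Rightarrow> real ^ 'n ^ 'n) \<Rightarrow> real \<Rightarrow> ('s \<Rightarrow> real ^ 'n) \<Rightarrow> bool" where
  "has_ito_integral M F B H T J \<longleftrightarrow>
     (\<lambda>(s, w). H s w) \<in> borel_measurable (restrict_space borel {0..T} \<Otimes>\<^sub>M F T) \<and>
     J \<in> borel_measurable M \<and>
     (\<exists>n \<tau> \<xi>. (\<forall>k. simple_integrand F (n k) (\<tau> k) (\<xi> k)) \<and>
        (\<lambda>k::nat. \<integral>\<^sup>+w. (\<integral>\<^sup>+s\<in>{0..T}.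
            ennreal ((norm (H s w - simple_process (n k) (\<tau> k) (\<xi> k) s w))\<^sup>2) \<partial>lborel) \<partial>M)
          \<longlonglongrightarrow> 0 \<and>
        (\<lambda>k::nat. \<integral>\<^sup>+w. ennreal ((norm (J w - simple_integral B (n k) (\<tau> k) (\<xi> k) T w))\<^sup>2) \<partial>M)
          \<longlonglongrightarrow> 0)"

text \<open>
  \<open>X\<close> solves \<open>dX = a(X) dB + c(X) dt\<close>, \<open>X 0 = x\<close>, on the filtered probability space \<open>(M, F)\<close>.
\<close>

definition sde_solution ::
    "(real ^ 'n \<Rightarrow> real ^ 'n ^ 'n) \<Rightarrow> (real ^ 'n \<Rightarrow> real ^ 'n) \<Rightarrow> real ^ 'n \<Rightarrow>
     's measure \<Rightarrow> (real \<Rightarrow> 's measure) \<Rightarrow> (real \<Rightarrow> 's \<Rightarrow> real ^ 'n) \<Rightarrow>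
     (real \<Rightarrow> 's \<Rightarrow> real ^ 'n) \<Rightarrow> bool" where
  "sde_solution a c x M F B X \<longleftrightarrow>
     prob_space M \<and> filtration (space M) F \<and> (\<forall>t\<ge>0. subalgebra M (F t)) \<and>
     brownian_motion M F B \<and>
     (\<forall>w\<in>space M. continuous_on {0..} (\<lambda>t. X t w)) \<and>
     (\<forall>t\<ge>0. X t \<in> borel_measurable (F t)) \<and>
     (AE w in M. X 0 w = x) \<and>
     (\<forall>t\<ge>0. \<exists>J. has_ito_integral M F B (\<lambda>s w. a (X s w)) t J \<and>
        (AE w in M. X t w = x + J w + integral {0..t} (\<lambda>s. c (X s w))))"

text \<open>
  The space of continuous paths on \<open>{0..}\<close>, with the \<open>\<sigma>\<close>-field generated by the coordinates (the
  Borel \<open>\<sigma>\<close>-field of locally uniform convergence). Its points are functions on \<open>real\<close> that are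
  \<open>undefined\<close> at negative times.
\<close>

definition path_space :: "(real \<Rightarrow> real ^ 'n) measure" where
  "path_space = restrict_space (\<Pi>\<^sub>M t\<in>{0..}. borel) {w. continuous_on {0..} w}"

text \<open>
  \<open>Q\<close> is the law of a solution of the equation. The solution may live on any filtered probability
  space; HOL does not quantify over types, so that space is taken to have pairs of paths as points.
  This is no restriction, since a solution with its Brownian motion can be transported to the
  space of paths of the pair \<open>(X, B)\<close>, endowed with the joint law. For the Lipschitz coefficients
  considered below the law is unique.
\<close>

definition sde_law ::
    "(real ^ 'n \<Rightarrow> real ^ 'n ^ 'n) \<Rightarrow> (real ^ 'n \<Rightarrow> real ^ 'n) \<Rightarrow> real ^ 'n \<Rightarrow>
     (real \<Rightarrow> real ^ 'n) measure \<Rightarrow> bool" where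
  "sde_law a c x Q \<longleftrightarrow>
     (\<exists>(M :: ((real \<Rightarrow> real ^ 'n) \<times> (real \<Rightarrow> real ^ 'n)) measure) F B X.
        sde_solution a c x M F B X \<and>
        Q = distr M path_space (\<lambda>w. \<lambda>t\<in>{0..}. X t w))"


section \<open>Diffusions in random environment\<close>

definition env_events ::
    "'w measure \<Rightarrow> (real ^ 'n \<Rightarrow> 'w \<Rightarrow> 'w) \<Rightarrow> ('w \<Rightarrow> real ^ 'n) \<Rightarrow> ('w \<Rightarrow> real ^ 'n ^ 'n) \<Rightarrow>
     (real ^ 'n) set \<Rightarrow> 'w set set" where
  "env_events P t b \<sigma> F = sigma_sets (space P)
     ({(\<lambda>\<omega>. b (t x \<omega>)) -` A \<inter> space P | x A. x \<in> F \<and> A \<in> sets borel} \<union>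
      {(\<lambda>\<omega>. \<sigma> (t x \<omega>)) -` A \<inter> space P | x A. x \<in> F \<and> A \<in> sets borel})"

text \<open>
  The standing assumptions. \<open>Q x \<omega>\<close> is the quenched law. The norm of a matrix is the library's
  (Euclidean) one; since all constants are arbitrary, another norm would do as well. In
  \<open>finite_range\<close> the convention \<open>setdist {} F = 0\<close> is harmless: the events of the empty
  set are trivial.
\<close>

locale diffusion_in_random_environment = prob_space P
  for P :: "'w measure" +
  fixes t :: "real ^ 'n \<Rightarrow> 'w \<Rightarrow> 'w"
    and b :: "'w \<Rightarrow> real ^ 'n"
    and \<sigma> :: "'w \<Rightarrow> real ^ 'n ^ 'n"
    and b_bar \<sigma>_bar K \<nu> R :: real
    and Q :: "real ^ 'n \<Rightarrow> 'w \<Rightarrow> (real \<Rightarrow> real ^ 'n) measure"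
  assumes shift_zero: "\<omega> \<in> space P \<Longrightarrow> t 0 \<omega> = \<omega>"
    and shift_add: "\<omega> \<in> space P \<Longrightarrow> t (x + y) \<omega> = t x (t y \<omega>)"
    and shift_measurable: "(\<lambda>(x, \<omega>). t x \<omega>) \<in> borel \<Otimes>\<^sub>M P \<rightarrow>\<^sub>M P"
    and shift_preserving: "distr P P (t x) = P"
    and b_measurable: "b \<in> borel_measurable P"
    and \<sigma>_measurable: "\<sigma> \<in> borel_measurable P"
    and constants_pos: "b_bar > 0" "\<sigma>_bar > 0" "K > 0" "\<nu> > 0" "R > 0"
    and b_bounded: "\<omega> \<in> space P \<Longrightarrow> norm (b \<omega>) \<le> b_bar"
    and \<sigma>_bounded: "\<omega> \<in> space P \<Longrightarrow> norm (\<sigma> \<omega>) \<le> \<sigma>_bar"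
    and lipschitz: "\<omega> \<in> space P \<Longrightarrow>
        norm (b (t x \<omega>) - b (t y \<omega>)) + norm (\<sigma> (t x \<omega>) - \<sigma> (t y \<omega>)) \<le> K * norm (x - y)"
    and elliptic: "\<omega> \<in> space P \<Longrightarrow>
        1 / \<nu> * (norm y)\<^sup>2 \<le> (norm (transpose (\<sigma> (t x \<omega>)) *v y))\<^sup>2 \<and>
        (norm (transpose (\<sigma> (t x \<omega>)) *v y))\<^sup>2 \<le> \<nu> * (norm y)\<^sup>2"
    and finite_range: "F \<in> sets borel \<Longrightarrow> F' \<in> sets borel \<Longrightarrow> setdist F F' > R \<Longrightarrow>
        indep_set (env_events P t b \<sigma> F) (env_events P t b \<sigma> F')"
    and quenched_law: "\<omega> \<in> space P \<Longrightarrow>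
        sde_law (\<lambda>y. \<sigma> (t y \<omega>)) (\<lambda>y. b (t y \<omega>)) x (Q x \<omega>)"

text \<open>
  The semidirect product of \<open>P\<close> and the kernel \<open>\<omega> \<mapsto> Q x \<omega>\<close>. This kernel is measurable, because the
  laws of the solutions depend measurably on the coefficients.
\<close>

definition annealed_law ::
    "'w measure \<Rightarrow> (real ^ 'n \<Rightarrow> 'w \<Rightarrow> (real \<Rightarrow> real ^ 'n) measure) \<Rightarrow> real ^ 'n \<Rightarrow>
     ('w \<times> (real \<Rightarrow> real ^ 'n)) measure" where
  "annealed_law P Q x =
     measure_of (space P \<times> space path_space) (sets (P \<Otimes>\<^sub>M path_space))
       (\<lambda>E. \<integral>\<^sup>+\<omega>. emeasure (Q x \<omega>) (Pair \<omega> -` E) \<partial>P)"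


section \<open>Condition (T)\<close>

text \<open>The exit time is \<open>\<infinity>\<close> for a path that stays in \<open>U\<close>.\<close>

definition exit_time :: "(real ^ 'n) set \<Rightarrow> (real \<Rightarrow> real ^ 'n) \<Rightarrow> ereal" where
  "exit_time U w = Inf (ereal ` {t. 0 \<le> t \<and> w t \<notin> U})"

definition slab :: "real ^ 'n \<Rightarrow> real \<Rightarrow> real \<Rightarrow> (real ^ 'n) set" where
  "slab l \<beta> L = {x. - \<beta> * L < x \<bullet> l \<and> x \<bullet> l < L}"

text \<open>The event that \<open>X\<close>, at its exit from the slab, satisfies \<open>X \<bullet> l < 0\<close>.\<close>

definition exit_backwards ::
    "real ^ 'n \<Rightarrow> real \<Rightarrow> real \<Rightarrow> (real \<Rightarrow> real ^ 'n) set" where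
  "exit_backwards l \<beta> L =
     {w. exit_time (slab l \<beta> L) w < \<infinity> \<and> w (real_of_ereal (exit_time (slab l \<beta> L) w)) \<bullet> l < 0}"

text \<open>The logarithm with \<open>log 0 = - \<infinity>\<close>, whereas \<open>ln 0 = 0\<close> in the library.\<close>

definition elog :: "real \<Rightarrow> ereal" where
  "elog p = (if p = 0 then - \<infinity> else ereal (ln p))"

definition condition_T ::
    "'w measure \<Rightarrow> (real ^ 'n \<Rightarrow> 'w \<Rightarrow> (real \<Rightarrow> real ^ 'n) measure) \<Rightarrow> real ^ 'n \<Rightarrow> bool" where
  "condition_T P Q l \<longleftrightarrow>
     (\<exists>N. open N \<and> l \<in> N \<and>
        (\<forall>l' \<in> N \<inter> sphere 0 1. \<forall>\<beta>>0.
           Limsup at_top (\<lambda>L. ereal (1 / L) *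
             elog (measure (annealed_law P Q 0)
               {z \<in> space (annealed_law P Q 0). snd z \<in> exit_backwards l' \<beta> L})) < 0))"

end

theory Submission
  imports Defs
begin

text \<open>
  Fix the environment and a unit vector \<open>u\<close> close to \<open>l\<close>, so that the drift in direction \<open>u\<close> is at
  least \<open>\<delta>' = \<delta> / 2\<close>. For \<open>\<gamma> = \<delta>' / \<nu>\<close> the process \<open>exp (- \<gamma> (X t \<bullet> u))\<close> is a supermartingale, and the
  maximal inequality bounds the probability that \<open>X \<bullet> u\<close> ever goes below \<open>- \<beta> L\<close> by
  \<open>exp (- \<gamma> \<beta> L / 2)\<close>, uniformly in the environment.

  No Ito formula is needed: for step integrands the exponential martingale is computed by
  conditioning on the past, and Fatou's lemma carries the resulting inequality over to Ito integrals.
\<close>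

section \<open>Exponential martingales of step integrands\<close>

text \<open>The obstacle is the form of the stochastic integral. \<open>has_ito_integral\<close>
  fixes one time \<open>T\<close> and asks for an L2 limit along some approximating sequence; it
  offers neither a process in \<open>T\<close>, nor a martingale, nor a link between the integrals
  over \<open>{0..s}\<close> and \<open>{0..t}\<close>. What survives the limit is an inequality for
  nonnegative exponentials, E[f exp(...)] \<le> E[f] with f measurable at time s, and this is all
  that a supermartingale needs. Hence everything is a \<open>nn_integral\<close> with a weight f:
  integrability never has to be shown, and the weight stands in for conditional expectation given
  \<open>F s\<close>. Only discrete times enter the maximal inequality. Path continuity recovers all
  times from dyadic ones at the price of half the level, whence the 1/2 in the exponent.\<close>

locale filtered_brownian_motion = prob_space M
  for M :: "'s measure" and F :: "real \<Rightarrow> 's measure" and B :: "real \<Rightarrow> 's \<Rightarrow> real ^ 'n" +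
  assumes filtration: "filtration (space M) F"
    and subalg: "0 \<le> t \<Longrightarrow> subalgebra M (F t)"
    and brownian: "brownian_motion M F B"
begin

lemma space_F [simp]: "space (F t) = space M"
  using filtration by (simp add: filtration_def)

lemma measurable_F_mono:
  assumes "s \<le> t" "f \<in> measurable (F s) N"
  shows "f \<in> measurable (F t) N"
proof -
  have "sets (F s) \<subseteq> sets (F t)"
    using filtration assms(1) by (simp add: filtration_def)
  then show ?thesis
    using assms(2) by (auto simp: measurable_def)
qed

lemma measurable_from_F:
  assumes "0 \<le> t" "f \<in> measurable (F t) N"
  shows "f \<in> measurable M N"
  using subalg[OF assms(1)] assms(2) by (auto simp: measurable_def subalgebra_def)

lemma B_measurable: "0 \<le> s \<Longrightarrow> s \<le> t \<Longrightarrow> B s \<in> borel_measurable (F t)"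
  using brownian measurable_F_mono unfolding brownian_motion_def by blast

text \<open>Independence makes the joint law of past and increment a product measure, so Fubini
  integrates out the increment with the past frozen.\<close>

lemma nn_integral_past_increment:
  assumes s: "0 \<le> s" "s < t"
    and h [measurable]: "h \<in> borel_measurable (F s \<Otimes>\<^sub>M borel)"
  shows "(\<integral>\<^sup>+w. h (w, B t w - B s w) \<partial>M) =
    (\<integral>\<^sup>+w. (\<integral>\<^sup>+y. ennreal (\<Prod>i\<in>UNIV. normal_density 0 (sqrt (t - s)) (y $ i)) * h (w, y) \<partial>lborel) \<partial>M)"
proof -
  let ?D = "\<lambda>w. B t w - B s w"
  let ?p = "\<lambda>y::real^'n. ennreal (\<Prod>i\<in>UNIV. normal_density 0 (sqrt (t - s)) (y $ i))"
  have ind: "indep_set (sets (F s)) {?D -` A \<inter> space M | A. A \<in> sets borel}"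
    and dist: "distributed M lborel ?D ?p"
    using brownian s unfolding brownian_motion_def by auto
  have D: "?D \<in> borel_measurable M"
    using distributed_measurable[OF dist] by simp
  \<comment> \<open>The identity, read as a map into \<open>F s\<close>, is the random variable that
    carries the whole past; its law is \<open>M\<close> restricted to \<open>F s\<close>.\<close>
  have id: "(\<lambda>w. w) \<in> measurable M (F s)"
    using measurable_from_F[OF s(1) measurable_ident_sets[OF refl]] by simp
  have pair: "(\<lambda>w. (w, ?D w)) \<in> measurable M (F s \<Otimes>\<^sub>M borel)"
    using id D by (rule measurable_Pair)
  interpret D: prob_space "distr M borel ?D"
    by (rule prob_space_distr[OF D])
  interpret Fs: prob_space "distr M (F s) (\<lambda>w. w)"
    by (rule prob_space_distr[OF id])
  have eq: "distr M (F s) (\<lambda>w. w) \<Otimes>\<^sub>M distr M borel ?D = distr M (F s \<Otimes>\<^sub>M borel) (\<lambda>w. (w, ?D w))"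
  proof (rule pair_measure_eqI)
    fix A C assume "A \<in> sets (distr M (F s) (\<lambda>w. w))" "C \<in> sets (distr M borel ?D)"
    then have A: "A \<in> sets (F s)" and C: "C \<in> sets borel" by auto
    have "A \<subseteq> space M" using sets.sets_into_space[OF A] by simp
    moreover have "prob (A \<inter> (?D -` C \<inter> space M)) = prob A * prob (?D -` C \<inter> space M)"
      using ind A C by (intro indep_setD[OF ind]) auto
    moreover have "(\<lambda>w. (w, ?D w)) -` (A \<times> C) \<inter> space M = A \<inter> (?D -` C \<inter> space M)"
      using \<open>A \<subseteq> space M\<close> by auto
    ultimately show "emeasure (distr M (F s) (\<lambda>w. w)) A * emeasure (distr M borel ?D) C =
        emeasure (distr M (F s \<Otimes>\<^sub>M borel) (\<lambda>w. (w, ?D w))) (A \<times> C)"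
      using A C id D pair
      by (simp add: emeasure_distr emeasure_eq_measure Int_absorb2 flip: ennreal_mult)
  qed (auto intro: D.sigma_finite_measure_axioms Fs.sigma_finite_measure_axioms)
  have "distr M borel ?D = distr M lborel ?D"
    by (rule distr_cong) auto
  then have dens: "distr M borel ?D = density lborel ?p"
    using distributed_distr_eq_density[OF dist] by simp
  have pm: "?p \<in> borel_measurable lborel"
    by measurable
  have "(\<integral>\<^sup>+w. h (w, ?D w) \<partial>M) = (\<integral>\<^sup>+z. h z \<partial>distr M (F s \<Otimes>\<^sub>M borel) (\<lambda>w. (w, ?D w)))"
    by (simp add: nn_integral_distr[OF pair])
  also have "\<dots> = (\<integral>\<^sup>+w. (\<integral>\<^sup>+y. h (w, y) \<partial>distr M borel ?D) \<partial>distr M (F s) (\<lambda>w. w))"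
    unfolding eq[symmetric] by (subst D.nn_integral_fst[symmetric]) auto
  also have "\<dots> = (\<integral>\<^sup>+w. (\<integral>\<^sup>+y. h (w, y) \<partial>distr M borel ?D) \<partial>M)"
    by (subst nn_integral_distr[OF id]) auto
  also have "\<dots> = (\<integral>\<^sup>+w. (\<integral>\<^sup>+y. ?p y * h (w, y) \<partial>lborel) \<partial>M)"
    unfolding dens
    by (intro nn_integral_cong nn_integral_density pm) (use measurable_Pair2[OF h] in auto)
  finally show ?thesis .
qed

end

section \<open>Gaussian exponential moments\<close>

lemma exp_times_normal_density:
  assumes "0 < \<tau>"
  shows "exp (v * y - v\<^sup>2 * \<tau> / 2) * normal_density 0 (sqrt \<tau>) y = normal_density (\<tau> * v) (sqrt \<tau>) y"
proof -
  have "v * y - v\<^sup>2 * \<tau> / 2 + (- y\<^sup>2 / (2 * \<tau>)) = - (y - \<tau> * v)\<^sup>2 / (2 * \<tau>)"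
    using assms by (simp add: field_simps power2_eq_square)
  then show ?thesis
    using assms unfolding normal_density_def by (simp add: mult.left_commute flip: exp_add)
qed

text \<open>Completing the square in each coordinate only moves the mean from 0 to
  \<open>\<tau> * v $ i\<close>; what remains is a product of probability densities.\<close>

lemma nn_integral_exp_gaussian:
  fixes v :: "real ^ 'n"
  assumes "0 < \<tau>"
  shows "(\<integral>\<^sup>+y. ennreal (\<Prod>i\<in>UNIV. normal_density 0 (sqrt \<tau>) (y $ i)) *
            ennreal (exp (v \<bullet> y - (norm v)\<^sup>2 * \<tau> / 2)) \<partial>lborel) = 1"
proof -
  have *: "exp (v \<bullet> y - (norm v)\<^sup>2 * \<tau> / 2) = (\<Prod>i\<in>UNIV. exp (v $ i * y $ i - (v $ i)\<^sup>2 * \<tau> / 2))" for y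
    by (simp add: inner_vec_def norm_eq_sqrt_inner power2_eq_square sum_subtractf sum_distrib_right
        sum_divide_distrib sum_nonneg flip: exp_sum)
  have B: "(\<Prod>b\<in>Basis. g b) = (\<Prod>i\<in>UNIV. g (axis i (1::real)))" for g :: "real^'n \<Rightarrow> ennreal"
    by (simp add: Basis_vec_def UNION_singleton_eq_range prod.reindex inj_on_def axis_eq_axis)
  have "(\<integral>\<^sup>+y. ennreal (\<Prod>i\<in>UNIV. normal_density 0 (sqrt \<tau>) (y $ i)) *
            ennreal (exp (v \<bullet> y - (norm v)\<^sup>2 * \<tau> / 2)) \<partial>lborel)
      = (\<integral>\<^sup>+y. (\<Prod>b\<in>Basis. ennreal (normal_density (\<tau> * (v \<bullet> b)) (sqrt \<tau>) (y \<bullet> b))) \<partial>lborel)"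
    unfolding * B
    by (intro nn_integral_cong)
      (simp add: inner_axis prod_ennreal prod_nonneg flip: ennreal_mult prod.distrib
        exp_times_normal_density[OF assms] mult.commute)
  also have "\<dots> = (\<Prod>b\<in>Basis. \<integral>\<^sup>+x. ennreal (normal_density (\<tau> * (v \<bullet> b)) (sqrt \<tau>) x) \<partial>lborel)"
    by (rule nn_integral_lborel_prod) auto
  also have "\<dots> = 1"
    using assms by (intro prod.neutral) (simp add: nn_integral_eq_integral)
  finally show ?thesis .
qed

context filtered_brownian_motion
begin

text \<open>Given the past, \<open>v\<close> is a constant vector and the inner Gaussian integral
  equals 1. This is the martingale property over one cell, with the weight \<open>f\<close> in place
  of conditioning.\<close>

lemma nn_integral_exp_increment:
  assumes s: "0 \<le> s" "s \<le> t"
    and f [measurable]: "f \<in> borel_measurable (F s)"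
    and v [measurable]: "v \<in> borel_measurable (F s)"
  shows "(\<integral>\<^sup>+w. f w * ennreal (exp (v w \<bullet> (B t w - B s w) - (norm (v w))\<^sup>2 * (t - s) / 2)) \<partial>M) = (\<integral>\<^sup>+w. f w \<partial>M)"
\<comment> \<open>\<open>brownian_motion\<close> describes increments for \<open>s < t\<close> only;
  at \<open>s = t\<close> the exponent is 0.\<close>
proof (cases "s = t")
  case False
  then have st: "s < t" using s by simp
  let ?h = "\<lambda>(w, y). f w * ennreal (exp (v w \<bullet> y - (norm (v w))\<^sup>2 * (t - s) / 2))"
  have "(\<integral>\<^sup>+w. ?h (w, B t w - B s w) \<partial>M) =
     (\<integral>\<^sup>+w. (\<integral>\<^sup>+y. ennreal (\<Prod>i\<in>UNIV. normal_density 0 (sqrt (t - s)) (y $ i)) * ?h (w, y) \<partial>lborel) \<partial>M)"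
    by (rule nn_integral_past_increment[OF s(1) st]) measurable
  also have "\<dots> = (\<integral>\<^sup>+w. f w \<partial>M)"
  proof (rule nn_integral_cong)
    fix w
    have "(\<integral>\<^sup>+y. ennreal (\<Prod>i\<in>UNIV. normal_density 0 (sqrt (t - s)) (y $ i)) * ?h (w, y) \<partial>lborel)
       = (\<integral>\<^sup>+y. f w * (ennreal (\<Prod>i\<in>UNIV. normal_density 0 (sqrt (t - s)) (y $ i)) *
             ennreal (exp (v w \<bullet> y - (norm (v w))\<^sup>2 * (t - s) / 2))) \<partial>lborel)"
      by (simp add: mult.left_commute)
    also have "\<dots> = f w"
      using nn_integral_exp_gaussian[of "t - s" "v w"] st by (subst nn_integral_cmult) auto
    finally show "(\<integral>\<^sup>+y. ennreal (\<Prod>i\<in>UNIV. normal_density 0 (sqrt (t - s)) (y $ i)) * ?h (w, y) \<partial>lborel) = f w" .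
  qed
  finally show ?thesis by simp
qed simp

end

text \<open>Since \<open>a\<close> and \<open>b\<close> are grid points, testing the right endpoint
  of a cell decides whether the whole cell lies in \<open>{a<..b}\<close>. It is applied to Brownian
  paths and to the identity, the latter computing lengths.\<close>

lemma sum_indicator_telescope:
  fixes f :: "real \<Rightarrow> 'a::real_vector" and g :: "nat \<Rightarrow> real"
  assumes g: "strict_mono_on {..m} g"
    and ab: "a \<le> b" "a \<in> g ` {..m}" "b \<in> g ` {..m}"
  shows "(\<Sum>j<m. indicator {a<..b} (g (Suc j)) *\<^sub>R (f (g (Suc j)) - f (g j))) = f b - f a"
proof -
  obtain p q where pq: "p \<le> m" "a = g p" "q \<le> m" "b = g q"
    using ab by auto
  have le: "p \<le> q"
    using strict_mono_on_less[OF g, of q p] pq ab(1) by auto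
  have "(\<Sum>j<m. indicator {a<..b} (g (Suc j)) *\<^sub>R (f (g (Suc j)) - f (g j)))
      = (\<Sum>j\<in>{p..<q}. f (g (Suc j)) - f (g j))"
  proof (rule sum.mono_neutral_cong_right)
    fix j assume j: "j \<in> {p..<q}"
    then have "g p < g (Suc j)" "g (Suc j) \<le> g q"
      using strict_mono_on_less[OF g, of p "Suc j"] strict_mono_on_less[OF g, of q "Suc j"] pq by auto
    then show "indicator {a<..b} (g (Suc j)) *\<^sub>R (f (g (Suc j)) - f (g j)) = f (g (Suc j)) - f (g j)"
      using pq by (simp add: indicator_def)
  next
    show "\<forall>j\<in>{..<m} - {p..<q}. indicator {a<..b} (g (Suc j)) *\<^sub>R (f (g (Suc j)) - f (g j)) = 0"
    proof
      fix j assume j: "j \<in> {..<m} - {p..<q}"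
      then have "\<not> (g p < g (Suc j) \<and> g (Suc j) \<le> g q)"
        using strict_mono_on_less[OF g, of p "Suc j"] strict_mono_on_less[OF g, of q "Suc j"] pq by auto
      then show "indicator {a<..b} (g (Suc j)) *\<^sub>R (f (g (Suc j)) - f (g j)) = 0"
        using pq by (auto simp: indicator_def)
    qed
  qed (use pq in auto)
  also have "\<dots> = f b - f a"
    using le pq by (simp add: sum_Suc_diff'[of p q "\<lambda>j. f (g j)"])
  finally show ?thesis .
qed

section \<open>Step integrands on a common grid\<close>

context filtered_brownian_motion
begin

text \<open>Induction removes the last cell: all earlier factors are known at time
  \<open>g m\<close> and join the weight. That needs the measurability of \<open>E m\<close> and the
  order of the grid, so the three claims are proved together.\<close>

lemma nn_integral_exp_grid:
  assumes g0: "0 \<le> g 0" and g: "\<And>j. j < m \<Longrightarrow> g j \<le> g (Suc j)"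
    and f: "f \<in> borel_measurable (F (g 0))"
    and h: "\<And>j. j < m \<Longrightarrow> h j \<in> borel_measurable (F (g j))"
  defines "E \<equiv> \<lambda>m w. exp (\<Sum>j<m. h j w \<bullet> (B (g (Suc j)) w - B (g j) w) - (norm (h j w))\<^sup>2 * (g (Suc j) - g j) / 2)"
  shows "(\<integral>\<^sup>+w. f w * ennreal (E m w) \<partial>M) = (\<integral>\<^sup>+w. f w \<partial>M)"
    and "E m \<in> borel_measurable (F (g m))"
    and "g 0 \<le> g m"
  using g h
proof (induction m)
  case 0
  { case 1 show ?case by (simp add: E_def) }
  { case 2 show ?case by (simp add: E_def) }
  { case 3 show ?case by simp }
next
  case (Suc m)
  have hm: "\<And>j. j < m \<Longrightarrow> h j \<in> borel_measurable (F (g j))" and gm: "\<And>j. j < m \<Longrightarrow> g j \<le> g (Suc j)"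
    and hm': "h m \<in> borel_measurable (F (g m))" and gm': "g m \<le> g (Suc m)"
    if "\<And>j. j < Suc m \<Longrightarrow> h j \<in> borel_measurable (F (g j))" "\<And>j. j < Suc m \<Longrightarrow> g j \<le> g (Suc j)"
    using that by auto
  have E: "E (Suc m) w = E m w * exp (h m w \<bullet> (B (g (Suc m)) w - B (g m) w) - (norm (h m w))\<^sup>2 * (g (Suc m) - g m) / 2)" for w
    by (simp add: E_def exp_add)
  { case 3
    then show ?case using Suc.IH(3)[OF gm hm] gm' by fastforce }
  { case 1
    have gm0: "g 0 \<le> g m" using Suc.IH(3)[OF gm hm] 1 by blast
    have [measurable]: "E m \<in> borel_measurable (F (g m))" using Suc.IH(2)[OF gm hm] 1 by blast
    have [measurable]: "f \<in> borel_measurable (F (g m))" "h m \<in> borel_measurable (F (g m))"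
      using measurable_F_mono[OF gm0 f] 1 by auto
    have "(\<integral>\<^sup>+w. f w * ennreal (E (Suc m) w) \<partial>M) =
      (\<integral>\<^sup>+w. f w * ennreal (E m w) * ennreal (exp (h m w \<bullet> (B (g (Suc m)) w - B (g m) w) - (norm (h m w))\<^sup>2 * (g (Suc m) - g m) / 2)) \<partial>M)"
      unfolding E by (simp add: ennreal_mult mult.assoc E_def)
    also have "\<dots> = (\<integral>\<^sup>+w. f w * ennreal (E m w) \<partial>M)"
      using gm0 g0 1 by (intro nn_integral_exp_increment) auto
    also have "\<dots> = (\<integral>\<^sup>+w. f w \<partial>M)"
      using Suc.IH(1)[OF gm hm] 1 by blast
    finally show ?case . }
  { case 2
    have gm0: "g 0 \<le> g m" using Suc.IH(3)[OF gm hm] 2 by blast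
    have gS: "g m \<le> g (Suc m)" using 2 by auto
    have [measurable]: "E m \<in> borel_measurable (F (g (Suc m)))"
      using measurable_F_mono[OF gS] Suc.IH(2)[OF gm hm] 2 by blast
    have [measurable]: "h m \<in> borel_measurable (F (g (Suc m)))"
      using measurable_F_mono[OF gS] 2 by blast
    have [measurable]: "B (g m) \<in> borel_measurable (F (g (Suc m)))" "B (g (Suc m)) \<in> borel_measurable (F (g (Suc m)))"
      using B_measurable gm0 g0 gS by auto
    show ?case unfolding E by measurable }
qed

text \<open>The intervals may overlap in any way. Refining them to the grid of all endpoints makes
  the total integrand constant on each cell, and the previous lemma applies with the values at right
  endpoints.\<close>

lemma nn_integral_exp_step_family:
  fixes a b :: "'i \<Rightarrow> real" and v :: "'i \<Rightarrow> 's \<Rightarrow> real ^ 'n"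
  assumes I: "finite I" and p: "0 \<le> p"
    and ab: "\<And>i. i \<in> I \<Longrightarrow> p \<le> a i" "\<And>i. i \<in> I \<Longrightarrow> a i \<le> b i"
    and v: "\<And>i. i \<in> I \<Longrightarrow> v i \<in> borel_measurable (F (a i))"
    and f: "f \<in> borel_measurable (F p)"
  defines "E \<equiv> \<lambda>w. exp ((\<Sum>i\<in>I. v i w \<bullet> (B (b i) w - B (a i) w))
        - (LINT r|lborel. (norm (\<Sum>i\<in>I. indicator {a i<..b i} r *\<^sub>R v i w))\<^sup>2) / 2)"
  shows "(\<integral>\<^sup>+w. f w * ennreal (E w) \<partial>M) = (\<integral>\<^sup>+w. f w \<partial>M)"
    and "E \<in> borel_measurable M"
proof -
  \<comment> \<open>\<open>p\<close> is included so that the grid starts at the time at which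
    \<open>f\<close> is known.\<close>
  define G where "G = insert p (a ` I \<union> b ` I)"
  define g where "g j = sorted_list_of_set G ! j" for j
  define m where "m = card G - 1"
  define h where "h r w = (\<Sum>i\<in>I. indicator {a i<..b i} r *\<^sub>R v i w)" for r w
  have finG: "finite G" using I by (simp add: G_def)
  have cG: "card G = Suc m"
    using finG by (simp add: m_def G_def card_gt_0_iff)
  have len: "length (sorted_list_of_set G) = Suc m" using finG cG by simp
  have sm: "strict_mono_on {..m} g"
  proof (rule strict_mono_onI)
    fix i j :: nat assume "i \<in> {..m}" "j \<in> {..m}" "i < j"
    then show "g i < g j"
      using sorted_wrt_nth_less[of "(<)" "sorted_list_of_set G" i j] strict_sorted_list_of_set[of G] len
      by (auto simp: g_def)
  qed
  have gG: "g ` {..m} = G"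
  proof -
    have "G = set (sorted_list_of_set G)" using finG by simp
    also have "\<dots> = g ` {..m}" unfolding set_conv_nth len g_def by (auto simp: less_Suc_eq_le)
    finally show ?thesis by simp
  qed
  have g_le: "g j \<le> g (Suc j)" if "j < m" for j
    using strict_mono_onD[OF sm, of j "Suc j"] that by simp
  have g_mono: "g i \<le> g j" if "i \<le> j" "j \<le> m" for i j
    using strict_mono_onD[OF sm, of i j] that by (cases "i = j") auto
  have Gp: "p \<le> x" if "x \<in> G" for x
    using that ab by (force simp: G_def)
  have g0: "g 0 = p"
  proof -
    obtain j where "j \<le> m" "p = g j" using gG unfolding G_def by (metis imageE insertI1 atMost_iff)
    then have "g 0 \<le> p" using g_mono[of 0 j] by simp
    moreover have "p \<le> g 0" using Gp gG by auto
    ultimately show ?thesis by simp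
  qed
  have hmeas: "h (g (Suc j)) \<in> borel_measurable (F (g j))" if "j < m" for j
    unfolding h_def
  proof (rule borel_measurable_sum)
    fix i assume i: "i \<in> I"
    show "(\<lambda>w. indicator {a i<..b i} (g (Suc j)) *\<^sub>R v i w) \<in> borel_measurable (F (g j))"
    proof (cases "g (Suc j) \<in> {a i<..b i}")
      \<comment> \<open>A grid point \<open>a i\<close> strictly below \<open>g (Suc j)\<close> is
        at most \<open>g j\<close>, so the value on the cell is already known at its left
        end.\<close>
      case True
      obtain q where q: "q \<le> m" "a i = g q" using gG i unfolding G_def by blast
      have "q < Suc j" using True q g_mono[of "Suc j" q] by force
      then have "a i \<le> g j" using q g_mono[of q j] that by simp
      then have "v i \<in> borel_measurable (F (g j))" using v[OF i] measurable_F_mono by blast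
      then show ?thesis using True by simp
    qed simp
  qed
  have U: "(\<Sum>i\<in>I. v i w \<bullet> (B (b i) w - B (a i) w)) = (\<Sum>j<m. h (g (Suc j)) w \<bullet> (B (g (Suc j)) w - B (g j) w))" for w
  proof -
    have "(\<Sum>i\<in>I. v i w \<bullet> (B (b i) w - B (a i) w)) =
       (\<Sum>i\<in>I. v i w \<bullet> (\<Sum>j<m. indicator {a i<..b i} (g (Suc j)) *\<^sub>R (B (g (Suc j)) w - B (g j) w)))"
      using ab gG by (intro sum.cong refl arg_cong2[where f = inner]
         sum_indicator_telescope[OF sm, of _ _ "\<lambda>t. B t w", symmetric]) (auto simp: G_def)
    also have "\<dots> = (\<Sum>j<m. h (g (Suc j)) w \<bullet> (B (g (Suc j)) w - B (g j) w))"
      unfolding h_def inner_sum_right inner_sum_left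
      by (subst sum.swap) simp
    finally show ?thesis .
  qed
  \<comment> \<open>The product of two interval indicators is the indicator of the intersection. The
    extra \<open>max\<close> turns an empty intersection into an interval with equal endpoints,
    which are again grid points.\<close>
  have sq: "(norm (h r w))\<^sup>2 = (\<Sum>i\<in>I. \<Sum>k\<in>I. (v i w \<bullet> v k w) * indicator {max (a i) (a k)<..max (max (a i) (a k)) (min (b i) (b k))} r)" for r w
    unfolding h_def power2_norm_eq_inner inner_sum_left inner_sum_right
    by (intro sum.cong refl) (auto simp: indicator_def inner_commute)
  have V: "(LINT r|lborel. (norm (h r w))\<^sup>2) = (\<Sum>j<m. (norm (h (g (Suc j)) w))\<^sup>2 * (g (Suc j) - g j))" for w
  proof -
    have "(LINT r|lborel. (norm (h r w))\<^sup>2) =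
      (\<Sum>i\<in>I. \<Sum>k\<in>I. (v i w \<bullet> v k w) * (max (max (a i) (a k)) (min (b i) (b k)) - max (a i) (a k)))"
      unfolding sq by (subst Bochner_Integration.integral_sum integral_mult_right_zero;
        (intro Bochner_Integration.integrable_sum integrable_mult_right integrable_real_indicator)?; simp)+
    also have "\<dots> = (\<Sum>i\<in>I. \<Sum>k\<in>I. (v i w \<bullet> v k w) * (\<Sum>j<m. indicator {max (a i) (a k)<..max (max (a i) (a k)) (min (b i) (b k))} (g (Suc j)) *\<^sub>R (g (Suc j) - g j)))"
      using gG by (intro sum.cong refl arg_cong2[where f = "(*)"]
         sum_indicator_telescope[OF sm, of _ _ "\<lambda>t. t", symmetric]) (auto simp: G_def max_def min_def)
    also have "\<dots> = (\<Sum>j<m. (norm (h (g (Suc j)) w))\<^sup>2 * (g (Suc j) - g j))"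
      unfolding sq sum_distrib_right sum_distrib_left
      by (simp only: sum.swap[of _ "{..<m}" I] mult.assoc real_scaleR_def)
    finally show ?thesis .
  qed
  have E: "E w = exp (\<Sum>j<m. h (g (Suc j)) w \<bullet> (B (g (Suc j)) w - B (g j) w) - (norm (h (g (Suc j)) w))\<^sup>2 * (g (Suc j) - g j) / 2)" for w
    unfolding E_def h_def[symmetric] U V by (simp add: sum_subtractf sum_divide_distrib)
  note grid = nn_integral_exp_grid[of g m f "\<lambda>j. h (g (Suc j))"]
  show "(\<integral>\<^sup>+w. f w * ennreal (E w) \<partial>M) = (\<integral>\<^sup>+w. f w \<partial>M)"
    unfolding E by (rule grid) (use g0 p g_le hmeas f in auto)
  have "E \<in> borel_measurable (F (g m))"
    unfolding E[abs_def] by (rule grid) (use g0 p g_le hmeas f in auto)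
  then show "E \<in> borel_measurable M"
    using measurable_from_F[of "g m"] g_mono[of 0 m] g0 p by simp
qed

end

section \<open>Matrix estimates and auxiliary inequalities\<close>

lemma linear_transpose_mult: "linear (\<lambda>A::real^'n^'m. transpose A *v x)"
  by (rule linearI)
    (simp_all add: vec_eq_iff matrix_vector_mult_def transpose_def algebra_simps sum.distrib sum_distrib_left)

lemma inner_matrix_vector_mult: "x \<bullet> (A *v y) = (transpose A *v x) \<bullet> (y :: real^'n)"
  for A :: "real^'n^'m"
  by (simp add: transpose_matrix_vector dot_lmul_matrix)

text \<open>The product is a combination of the rows of \<open>A\<close>, and the norm is Euclidean,
  so this is Cauchy-Schwarz over the rows.\<close>

lemma norm_transpose_mult_le:
  fixes A :: "real^'n^'m"
  shows "norm (transpose A *v x) \<le> norm A * norm x"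
proof -
  have eq: "transpose A *v x = (\<Sum>i\<in>UNIV. x $ i *\<^sub>R A $ i)"
    by (simp add: vec_eq_iff matrix_vector_mult_def transpose_def mult.commute)
  have "norm (transpose A *v x) \<le> (\<Sum>i\<in>UNIV. \<bar>norm (x $ i)\<bar> * \<bar>norm (A $ i)\<bar>)"
    unfolding eq by (rule order_trans[OF norm_sum]) simp
  also have "\<dots> \<le> norm x * norm A"
    unfolding norm_vec_def by (rule L2_set_mult_ineq)
  finally show ?thesis by (simp add: mult.commute)
qed

lemma borel_measurable_matrix_vector_mult [measurable]:
  fixes A :: "'a \<Rightarrow> real^'n^'m"
  assumes "A \<in> borel_measurable M" "x \<in> borel_measurable M"
  shows "(\<lambda>w. A w *v x w) \<in> borel_measurable M"
  by (rule borel_measurable_continuous_Pair[OF assms])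
    (auto simp: matrix_vector_mult_def intro!: continuous_intros continuous_on_vec_lambda)

lemma borel_measurable_transpose [measurable]:
  fixes A :: "'a \<Rightarrow> real^'n^'m"
  assumes "A \<in> borel_measurable M"
  shows "(\<lambda>w. transpose (A w)) \<in> borel_measurable M"
proof -
  have "continuous_on UNIV (transpose :: real^'n^'m \<Rightarrow> real^'m^'n)"
    unfolding transpose_def[abs_def] by (intro continuous_intros continuous_on_vec_lambda)
  then show ?thesis
    using borel_measurable_continuous_onI measurable_compose[OF assms] by blast
qed

text \<open>A Bochner integral without integrability defaults to 0, so the upper bound holds in
  either case.\<close>

lemma ennreal_integral_le_nn_integral:
  assumes "\<And>x. 0 \<le> g x"
  shows "ennreal (integral\<^sup>L M g) \<le> (\<integral>\<^sup>+x. ennreal (g x) \<partial>M)"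
proof (cases "integrable M g")
  case True
  then show ?thesis using assms by (simp add: nn_integral_eq_integral)
qed (simp add: not_integrable_integral_eq)

lemma power2_norm_add_le:
  fixes x y :: "'a::real_inner"
  shows "(norm (x + y))\<^sup>2 \<le> 2 * (norm x)\<^sup>2 + 2 * (norm y)\<^sup>2"
proof -
  have "(norm (x + y))\<^sup>2 + (norm (x - y))\<^sup>2 = 2 * (norm x)\<^sup>2 + 2 * (norm y)\<^sup>2"
    by (simp add: power2_norm_eq_inner inner_add_left inner_add_right inner_diff_left inner_diff_right)
  then show ?thesis by (smt (verit) zero_le_power2)
qed

section \<open>Simple integrals between two times\<close>

context filtered_brownian_motion
begin

text \<open>The difference of two simple integrals on unrelated grids is a single step family,
  indexed by a disjoint sum and with the second half negated. The difference is what compares two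
  approximations of one integrand; an empty second integrand gives the case of a single one.\<close>

lemma nn_integral_exp_simple_integral:
  fixes \<theta> :: "real ^ 'n"
  assumes si: "simple_integrand F n \<tau> \<xi>" "simple_integrand F n' \<tau>' \<xi>'"
    and st: "0 \<le> s" "s \<le> t"
    and f: "f \<in> borel_measurable (F s)"
  defines "E \<equiv> \<lambda>w. exp (\<theta> \<bullet> ((simple_integral B n \<tau> \<xi> t w - simple_integral B n \<tau> \<xi> s w)
            - (simple_integral B n' \<tau>' \<xi>' t w - simple_integral B n' \<tau>' \<xi>' s w))
        - (LINT r|lborel. indicator {s<..t} r *
            (norm (transpose (simple_process n \<tau> \<xi> r w - simple_process n' \<tau>' \<xi>' r w) *v \<theta>))\<^sup>2) / 2)"
  shows "(\<integral>\<^sup>+w. f w * ennreal (E w) \<partial>M) = (\<integral>\<^sup>+w. f w \<partial>M)"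
    and "E \<in> borel_measurable M"
proof -
  \<comment> \<open>Clamping the grid to \<open>{s..t}\<close> turns the increment of the integral
    from \<open>s\<close> to \<open>t\<close> into a sum over the clamped cells.\<close>
  define cl where "cl x = max s (min x t)" for x
  define I where "I = {..<n} <+> {..<n'}"
  define a where "a = case_sum (\<lambda>i. cl (\<tau> i)) (\<lambda>i. cl (\<tau>' i))"
  define b where "b = case_sum (\<lambda>i. cl (\<tau> (Suc i))) (\<lambda>i. cl (\<tau>' (Suc i)))"
  \<comment> \<open>If \<open>\<tau> i \<ge> t\<close>, the clamped cell is empty, but
    \<open>\<xi> i\<close> need not be known at its clamped left end \<open>t\<close>; the value 0
    restores adaptedness without changing the sum.\<close>
  define v where "v = case_sum (\<lambda>i w. if \<tau> i < t then transpose (\<xi> i w) *v \<theta> else 0)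
     (\<lambda>i w. if \<tau>' i < t then - (transpose (\<xi>' i w) *v \<theta>) else 0)"
  have inc: "\<theta> \<bullet> (simple_integral B n \<tau> \<xi> t w - simple_integral B n \<tau> \<xi> s w) =
     (\<Sum>i<n. (if \<tau> i < t then transpose (\<xi> i w) *v \<theta> else 0) \<bullet> (B (cl (\<tau> (Suc i))) w - B (cl (\<tau> i)) w))"
    if "simple_integrand F n \<tau> \<xi>" for n \<tau> \<xi> w
  proof -
    have cl: "B (cl x) w = B (min x t) w - B (min x s) w + B s w" for x
      using st by (auto simp: cl_def min_def max_def)
    have z: "B (cl (\<tau> (Suc i))) w - B (cl (\<tau> i)) w = 0" if "\<not> \<tau> i < t" "i < n" for i
    proof -
      have "\<tau> i < \<tau> (Suc i)" using that(2) \<open>simple_integrand F n \<tau> \<xi>\<close> by (auto simp: simple_integrand_def)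
      then show ?thesis using that(1) st by (auto simp: cl_def min_def max_def)
    qed
    have "\<theta> \<bullet> (simple_integral B n \<tau> \<xi> t w - simple_integral B n \<tau> \<xi> s w) =
      (\<Sum>i<n. \<theta> \<bullet> (\<xi> i w *v (B (cl (\<tau> (Suc i))) w - B (cl (\<tau> i)) w)))"
      unfolding simple_integral_def cl
      by (simp add: inner_sum_right matrix_vector_mult_diff_distrib algebra_simps inner_diff_right flip: sum_subtractf)
    also have "\<dots> = (\<Sum>i<n. (if \<tau> i < t then transpose (\<xi> i w) *v \<theta> else 0) \<bullet> (B (cl (\<tau> (Suc i))) w - B (cl (\<tau> i)) w))"
      by (intro sum.cong refl) (use z in \<open>auto simp: inner_matrix_vector_mult\<close>)
    finally show ?thesis .
  qed
  have proc: "(\<Sum>i<n. indicator {cl (\<tau> i)<..cl (\<tau> (Suc i))} r *\<^sub>R (if \<tau> i < t then transpose (\<xi> i w) *v \<theta> else 0))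
     = indicator {s<..t} r *\<^sub>R (transpose (simple_process n \<tau> \<xi> r w) *v \<theta>)" for n \<tau> \<xi> r w
  proof -
    have "indicator {s<..t} r *\<^sub>R (transpose (simple_process n \<tau> \<xi> r w) *v \<theta>) =
       (\<Sum>i<n. (indicator {s<..t} r * indicator {\<tau> i<..\<tau> (Suc i)} r) *\<^sub>R (transpose (\<xi> i w) *v \<theta>))"
      unfolding simple_process_def linear_sum[OF linear_transpose_mult] linear_scale[OF linear_transpose_mult] scaleR_sum_right
      by simp
    also have "\<dots> = (\<Sum>i<n. indicator {cl (\<tau> i)<..cl (\<tau> (Suc i))} r *\<^sub>R (if \<tau> i < t then transpose (\<xi> i w) *v \<theta> else 0))"
      using st by (intro sum.cong refl) (auto simp: indicator_def cl_def)
    finally show ?thesis ..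
  qed
  have meas: "(\<lambda>w. if \<tau> i < t then transpose (\<xi> i w) *v \<theta> else 0) \<in> borel_measurable (F (cl (\<tau> i)))"
    if "simple_integrand F n \<tau> \<xi>" "i < n" for n \<tau> \<xi> i
  proof (cases "\<tau> i < t")
    case True
    then have "\<tau> i \<le> cl (\<tau> i)" by (simp add: cl_def)
    then have [measurable]: "\<xi> i \<in> borel_measurable (F (cl (\<tau> i)))"
      using that measurable_F_mono unfolding simple_integrand_def by blast
    show ?thesis using True by (simp del: transpose_matrix_vector)
  qed simp
  have mono: "cl (\<tau> i) \<le> cl (\<tau> (Suc i))" if "simple_integrand F n \<tau> \<xi>" "i < n" for n \<tau> \<xi> i
  proof -
    have "\<tau> i < \<tau> (Suc i)" using that by (auto simp: simple_integrand_def)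
    then show ?thesis by (auto simp: cl_def)
  qed
  have E: "E w = exp ((\<Sum>i\<in>I. v i w \<bullet> (B (b i) w - B (a i) w))
        - (LINT r|lborel. (norm (\<Sum>i\<in>I. indicator {a i<..b i} r *\<^sub>R v i w))\<^sup>2) / 2)" for w
  proof -
    have "(\<Sum>i\<in>I. v i w \<bullet> (B (b i) w - B (a i) w)) =
      \<theta> \<bullet> ((simple_integral B n \<tau> \<xi> t w - simple_integral B n \<tau> \<xi> s w)
            - (simple_integral B n' \<tau>' \<xi>' t w - simple_integral B n' \<tau>' \<xi>' s w))"
      unfolding inner_diff_right[of \<theta> "_ - _" "_ - _"] inc[OF si(1)] inc[OF si(2)] I_def a_def b_def v_def
      by (simp add: sum.Plus if_distrib[of uminus] flip: sum_negf)
        (intro sum.cong refl, auto)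
    moreover have "(norm (\<Sum>i\<in>I. indicator {a i<..b i} r *\<^sub>R v i w))\<^sup>2 = indicator {s<..t} r *
            (norm (transpose (simple_process n \<tau> \<xi> r w - simple_process n' \<tau>' \<xi>' r w) *v \<theta>))\<^sup>2" for r
    proof -
      have "(\<Sum>i\<in>I. indicator {a i<..b i} r *\<^sub>R v i w) =
        (\<Sum>i<n. indicator {cl (\<tau> i)<..cl (\<tau> (Suc i))} r *\<^sub>R (if \<tau> i < t then transpose (\<xi> i w) *v \<theta> else 0))
      - (\<Sum>i<n'. indicator {cl (\<tau>' i)<..cl (\<tau>' (Suc i))} r *\<^sub>R (if \<tau>' i < t then transpose (\<xi>' i w) *v \<theta> else 0))"
        unfolding I_def a_def b_def v_def sum.Plus[OF finite_lessThan finite_lessThan] diff_conv_add_uminus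
          sum_negf[symmetric]
        by (intro arg_cong2[where f = "(+)"] sum.cong refl) auto
      also have "\<dots> = indicator {s<..t} r *\<^sub>R (transpose (simple_process n \<tau> \<xi> r w - simple_process n' \<tau>' \<xi>' r w) *v \<theta>)"
        unfolding proc linear_diff[OF linear_transpose_mult] scaleR_diff_right ..
      finally show ?thesis by (simp add: indicator_def)
    qed
    ultimately show ?thesis by (simp add: E_def)
  qed
  have fin: "finite I" by (simp add: I_def)
  have 1: "s \<le> a i" "a i \<le> b i" "v i \<in> borel_measurable (F (a i))" if "i \<in> I" for i
    using that mono[OF si(1)] mono[OF si(2)] meas[OF si(1)] borel_measurable_uminus[OF meas[OF si(2)]]
    by (auto simp: I_def a_def b_def v_def cl_def if_distrib[of uminus] cong: if_cong)
  show "(\<integral>\<^sup>+w. f w * ennreal (E w) \<partial>M) = (\<integral>\<^sup>+w. f w \<partial>M)"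
    unfolding E using fin st(1) 1 f by (rule nn_integral_exp_step_family(1))
  show "E \<in> borel_measurable M"
    unfolding E[abs_def] using fin st(1) 1 f by (rule nn_integral_exp_step_family(2))
qed

lemma simple_integrand_nonneg:
  assumes "simple_integrand F n \<tau> \<xi>" "i \<le> n"
  shows "0 \<le> \<tau> i"
  using assms(2)
proof (induction i)
  case (Suc i)
  then have "\<tau> i < \<tau> (Suc i)" using assms by (auto simp: simple_integrand_def)
  then show ?case using Suc by simp
qed (use assms in \<open>auto simp: simple_integrand_def\<close>)

lemma simple_integrand_measurable:
  assumes "simple_integrand F n \<tau> \<xi>" "i < n"
  shows "\<xi> i \<in> borel_measurable M"
  using assms simple_integrand_nonneg[OF assms(1), of i]
  by (intro measurable_from_F[of "\<tau> i"]) (auto simp: simple_integrand_def)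

lemma simple_integral_0:
  assumes "simple_integrand F n \<tau> \<xi>"
  shows "simple_integral B n \<tau> \<xi> 0 w = 0"
  using simple_integrand_nonneg[OF assms]
  by (auto simp: simple_integral_def min_absorb2 intro!: sum.neutral)

lemma simple_integral_measurable:
  assumes "simple_integrand F n \<tau> \<xi>" "0 \<le> T"
  shows "simple_integral B n \<tau> \<xi> T \<in> borel_measurable M"
  unfolding simple_integral_def[abs_def]
proof (rule borel_measurable_sum)
  fix i assume i: "i \<in> {..<n}"
  then have [measurable]: "\<xi> i \<in> borel_measurable M"
    using simple_integrand_measurable[OF assms(1)] by simp
  have "0 \<le> \<tau> i" "0 \<le> \<tau> (Suc i)"
    using i simple_integrand_nonneg[OF assms(1)] by auto
  then have [measurable]: "B (min (\<tau> (Suc i)) T) \<in> borel_measurable M" "B (min (\<tau> i) T) \<in> borel_measurable M"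
    using assms(2) by (auto intro!: measurable_from_F[OF _ B_measurable[OF _ order_refl]])
  show "(\<lambda>w. \<xi> i w *v (B (min (\<tau> (Suc i)) T) w - B (min (\<tau> i) T) w)) \<in> borel_measurable M"
    by measurable
qed

lemma simple_process_measurable:
  assumes "simple_integrand F n \<tau> \<xi>"
  shows "(\<lambda>(r, w). simple_process n \<tau> \<xi> r w) \<in> borel_measurable (borel \<Otimes>\<^sub>M M)"
  unfolding simple_process_def split_beta'
proof (rule borel_measurable_sum)
  fix i assume i: "i \<in> {..<n}"
  then have [measurable]: "\<xi> i \<in> borel_measurable M"
    using simple_integrand_measurable[OF assms] by simp
  show "(\<lambda>z. indicat_real {\<tau> i<..\<tau> (Suc i)} (fst z) *\<^sub>R \<xi> i (snd z)) \<in> borel_measurable (borel \<Otimes>\<^sub>M M)"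
    by measurable
qed

end

section \<open>Exponential supermartingales of Ito integrals\<close>

text \<open>The series of the \<open>g k\<close> has a finite integral, so it converges almost
  everywhere and its terms vanish.\<close>

lemma AE_tendsto_0_of_summable_nn_integral:
  fixes g :: "nat \<Rightarrow> 'a \<Rightarrow> ennreal"
  assumes g [measurable]: "\<And>k. g k \<in> borel_measurable M"
    and le: "\<And>k. (\<integral>\<^sup>+x. g k x \<partial>M) \<le> ennreal (c k)"
    and c: "\<And>k. 0 \<le> c k" "summable c"
  shows "AE x in M. (\<lambda>k. g k x) \<longlonglongrightarrow> 0"
proof -
  have "(\<integral>\<^sup>+x. (\<Sum>k. g k x) \<partial>M) = (\<Sum>k. \<integral>\<^sup>+x. g k x \<partial>M)"
    by (rule nn_integral_suminf) simp
  also have "\<dots> \<le> (\<Sum>k. ennreal (c k))"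
    by (rule suminf_le) (use le in auto)
  also have "\<dots> < \<infinity>"
    using c by (simp add: suminf_ennreal2)
  finally have "(\<integral>\<^sup>+x. (\<Sum>k. g k x) \<partial>M) \<noteq> \<infinity>"
    by simp
  then have "AE x in M. (\<Sum>k. g k x) \<noteq> \<infinity>"
    by (intro nn_integral_PInf_AE) auto
  then show ?thesis
  proof eventually_elim
    case (elim x)
    have fin: "g k x < \<infinity>" for k
    proof -
      have "g k x \<le> (\<Sum>k. g k x)"
        using sum_le_suminf[of "\<lambda>k. g k x" "{k}"] by simp
      then show ?thesis using elim by (simp add: less_top le_less_trans)
    qed
    then have eq: "g k x = ennreal (enn2real (g k x))" for k
      by simp
    then have "(\<Sum>k. ennreal (enn2real (g k x))) \<noteq> top"
      using elim by simp
    then have "summable (\<lambda>k. enn2real (g k x))"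
      by (intro summable_suminf_not_top) auto
    then have "(\<lambda>k. ennreal (enn2real (g k x))) \<longlonglongrightarrow> ennreal 0"
      by (intro tendsto_ennrealI summable_LIMSEQ_zero)
    then show ?case using eq by simp
  qed
qed

context filtered_brownian_motion
begin

text \<open>Passing to a subsequence fixes the rate. With \<open>(1/4)^k\<close> the errors remain
  summable after the multiplication by \<open>2^k\<close> that the comparison of two approximations
  will require.\<close>

lemma has_ito_integral_fast:
  assumes "has_ito_integral M F B H T J"
  shows "\<exists>n \<tau> \<xi>. \<forall>k. simple_integrand F (n k) (\<tau> k) (\<xi> k) \<and>
     (\<integral>\<^sup>+w. (\<integral>\<^sup>+s\<in>{0..T}. ennreal ((norm (H s w - simple_process (n k) (\<tau> k) (\<xi> k) s w))\<^sup>2) \<partial>lborel) \<partial>M)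
       \<le> ennreal ((1/4)^k) \<and>
     (\<integral>\<^sup>+w. ennreal ((norm (J w - simple_integral B (n k) (\<tau> k) (\<xi> k) T w))\<^sup>2) \<partial>M) \<le> ennreal ((1/4)^k)"
proof -
  obtain n \<tau> \<xi> where si: "\<And>k. simple_integrand F (n k) (\<tau> k) (\<xi> k)"
    and 1: "(\<lambda>k::nat. \<integral>\<^sup>+w. (\<integral>\<^sup>+s\<in>{0..T}. ennreal ((norm (H s w - simple_process (n k) (\<tau> k) (\<xi> k) s w))\<^sup>2) \<partial>lborel) \<partial>M) \<longlonglongrightarrow> 0"
    and 2: "(\<lambda>k::nat. \<integral>\<^sup>+w. ennreal ((norm (J w - simple_integral B (n k) (\<tau> k) (\<xi> k) T w))\<^sup>2) \<partial>M) \<longlonglongrightarrow> 0"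
    using assms unfolding has_ito_integral_def by blast
  define G where "G m = (\<integral>\<^sup>+w. (\<integral>\<^sup>+s\<in>{0..T}. ennreal ((norm (H s w - simple_process (n m) (\<tau> m) (\<xi> m) s w))\<^sup>2) \<partial>lborel) \<partial>M)" for m
  define D where "D m = (\<integral>\<^sup>+w. ennreal ((norm (J w - simple_integral B (n m) (\<tau> m) (\<xi> m) T w))\<^sup>2) \<partial>M)" for m
  have "\<forall>k. \<exists>m. G m \<le> ennreal ((1/4)^k) \<and> D m \<le> ennreal ((1/4)^k)"
  proof
    fix k :: nat
    have pos: "(0::ennreal) < ennreal ((1/4)^k)" by simp
    have "\<forall>\<^sub>F m in sequentially. G m < ennreal ((1/4)^k) \<and> D m < ennreal ((1/4)^k)"
      using order_tendstoD(2)[OF 1 pos] order_tendstoD(2)[OF 2 pos] unfolding G_def D_def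
      by (rule eventually_conj)
    then obtain m where "G m < ennreal ((1/4)^k) \<and> D m < ennreal ((1/4)^k)"
      unfolding eventually_sequentially by blast
    then show "\<exists>m. G m \<le> ennreal ((1/4)^k) \<and> D m \<le> ennreal ((1/4)^k)"
      by (intro exI[of _ m]) auto
  qed
  then obtain m where "\<forall>k. G (m k) \<le> ennreal ((1/4)^k) \<and> D (m k) \<le> ennreal ((1/4)^k)"
    by (rule choice[THEN exE])
  then show ?thesis
    unfolding G_def D_def
    by (intro exI[of _ "\<lambda>k. n (m k)"] exI[of _ "\<lambda>k. \<tau> (m k)"] exI[of _ "\<lambda>k. \<xi> (m k)"]) (simp add: si)
qed

text \<open>\<open>H\<close> is jointly measurable on \<open>{0..T}\<close> only, so the argument
  runs on Lebesgue measure restricted to that interval, which is finite and hence admits measurable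
  partial integrals.\<close>

lemma simple_approximation_error_measurable:
  fixes H :: "real \<Rightarrow> 's \<Rightarrow> real ^ 'n ^ 'n"
  assumes H: "(\<lambda>(s, w). H s w) \<in> borel_measurable (restrict_space borel {0..T} \<Otimes>\<^sub>M F T)" and T: "0 \<le> T"
    and si: "simple_integrand F n \<tau> \<xi>"
  defines "e \<equiv> \<lambda>r w. ennreal ((norm (H r w - simple_process n \<tau> \<xi> r w))\<^sup>2)"
  shows "(\<lambda>w. \<integral>\<^sup>+r\<in>{0..T}. e r w \<partial>lborel) \<in> borel_measurable M"
    and "w \<in> space M \<Longrightarrow> (\<lambda>r. e r w * indicator {0..T} r) \<in> borel_measurable borel"
proof -
  define L :: "real measure" where "L = restrict_space lborel {0..T}"
  have L: "(\<lambda>r. r) \<in> measurable L (restrict_space borel {0..T})" "(\<lambda>r. r) \<in> measurable L borel"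
  proof -
    have "sets L = sets (restrict_space borel {0..T})"
      unfolding L_def by (rule sets_restrict_space_cong) simp
    then show "(\<lambda>r. r) \<in> measurable L (restrict_space borel {0..T})"
      by (rule measurable_ident_sets)
    then show "(\<lambda>r. r) \<in> measurable L borel"
      by (simp add: measurable_restrict_space2_iff)
  qed
  have id: "(\<lambda>w. w) \<in> measurable M (F T)"
    using measurable_from_F[OF T measurable_ident_sets[OF refl]] by simp
  have 1: "(\<lambda>z. H (fst z) (snd z)) \<in> borel_measurable (L \<Otimes>\<^sub>M M)"
  proof -
    have "(\<lambda>z. (fst z, snd z)) \<in> measurable (L \<Otimes>\<^sub>M M) (restrict_space borel {0..T} \<Otimes>\<^sub>M F T)"
      by (intro measurable_Pair measurable_compose[OF measurable_fst L(1)] measurable_compose[OF measurable_snd id])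
    from measurable_compose[OF this H] show ?thesis by simp
  qed
  have 2: "(\<lambda>z. simple_process n \<tau> \<xi> (fst z) (snd z)) \<in> borel_measurable (L \<Otimes>\<^sub>M M)"
  proof -
    have "(\<lambda>z. (fst z, snd z)) \<in> measurable (L \<Otimes>\<^sub>M M) (borel \<Otimes>\<^sub>M M)"
      by (intro measurable_Pair measurable_compose[OF measurable_fst L(2)] measurable_snd)
    from measurable_compose[OF this simple_process_measurable[OF si]] show ?thesis by simp
  qed
  have e: "(\<lambda>z. e (fst z) (snd z)) \<in> borel_measurable (L \<Otimes>\<^sub>M M)"
    unfolding e_def using 1 2 by measurable
  have set: "{0..T} \<inter> space lborel \<in> sets lborel" by simp
  interpret L: finite_measure L
    unfolding L_def by (rule finite_measureI) (use T in \<open>simp add: emeasure_restrict_space space_restrict_space\<close>)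
  have "(\<lambda>(w, r). e r w) \<in> borel_measurable (M \<Otimes>\<^sub>M L)"
    using measurable_pair_swap[OF e] by (simp add: split_beta')
  then have "(\<lambda>w. \<integral>\<^sup>+r. e r w \<partial>L) \<in> borel_measurable M"
    by (rule L.borel_measurable_nn_integral)
  then show "(\<lambda>w. \<integral>\<^sup>+r\<in>{0..T}. e r w \<partial>lborel) \<in> borel_measurable M"
    unfolding L_def nn_integral_restrict_space[OF set] .
  assume w: "w \<in> space M"
  have "(\<lambda>r. e (fst (r, w)) (snd (r, w))) \<in> borel_measurable L"
    by (rule measurable_compose[OF measurable_Pair2'[OF w] e])
  then have "(\<lambda>r. e r w) \<in> borel_measurable (restrict_space lborel {0..T})"
    by (simp only: fst_conv snd_conv L_def)
  then have "(\<lambda>r. e r w * indicator {0..T} r) \<in> borel_measurable lborel"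
    by (rule borel_measurable_restrict_space_iff_ennreal[OF set, THEN iffD1])
  then show "(\<lambda>r. e r w * indicator {0..T} r) \<in> borel_measurable borel"
    by simp
qed

text \<open>
  The definition of \<open>has_ito_integral\<close> provides unrelated approximations \<open>I k\<close> of \<open>J\<close> and \<open>I' k\<close> of \<open>J'\<close>.
  On \<open>{0..s}\<close> they are reconciled by the exponential martingale itself: \<open>Y k\<close> below has mean 1, so
  that \<open>Y k < 2 ^ k\<close> eventually, which bounds \<open>\<theta> \<bullet> (I k s - I' k s)\<close> by a null sequence.
\<close>

lemma nn_integral_exp_ito_increment:
  fixes H :: "real \<Rightarrow> 's \<Rightarrow> real ^ 'n ^ 'n" and \<theta> :: "real ^ 'n"
  assumes st: "0 \<le> s" "s \<le> t"
    and J: "has_ito_integral M F B H t J" and J': "has_ito_integral M F B H s J'"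
    and \<kappa>: "\<And>r w. r \<in> {0..t} \<Longrightarrow> w \<in> space M \<Longrightarrow> (norm (transpose (H r w) *v \<theta>))\<^sup>2 \<le> \<kappa>"
    and f [measurable]: "f \<in> borel_measurable (F s)" and f0: "\<And>w. 0 \<le> f w"
  shows "(\<integral>\<^sup>+w. ennreal (f w * exp (\<theta> \<bullet> (J w - J' w) - \<kappa> * (t - s))) \<partial>M) \<le> (\<integral>\<^sup>+w. ennreal (f w) \<partial>M)"
proof -
  have t: "0 \<le> t" using st by simp
  have fM [measurable]: "f \<in> borel_measurable M"
    using measurable_from_F[OF st(1) f] .
  have \<kappa>0: "0 \<le> \<kappa>"
  proof -
    obtain w where "w \<in> space M" using not_empty by blast
    then have "(norm (transpose (H 0 w) *v \<theta>))\<^sup>2 \<le> \<kappa>" using \<kappa>[of 0] t by simp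
    then show ?thesis by (rule order_trans[OF zero_le_power2])
  qed
  obtain n \<tau> \<xi> where si: "\<And>k. simple_integrand F (n k) (\<tau> k) (\<xi> k)"
    and R: "\<And>k. (\<integral>\<^sup>+w. (\<integral>\<^sup>+s\<in>{0..t}. ennreal ((norm (H s w - simple_process (n k) (\<tau> k) (\<xi> k) s w))\<^sup>2) \<partial>lborel) \<partial>M) \<le> ennreal ((1/4)^k)"
    and S: "\<And>k. (\<integral>\<^sup>+w. ennreal ((norm (J w - simple_integral B (n k) (\<tau> k) (\<xi> k) t w))\<^sup>2) \<partial>M) \<le> ennreal ((1/4)^k)"
    using has_ito_integral_fast[OF J] by blast
  obtain n' \<tau>' \<xi>' where si': "\<And>k. simple_integrand F (n' k) (\<tau>' k) (\<xi>' k)"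
    and R': "\<And>k. (\<integral>\<^sup>+w. (\<integral>\<^sup>+r\<in>{0..s}. ennreal ((norm (H r w - simple_process (n' k) (\<tau>' k) (\<xi>' k) r w))\<^sup>2) \<partial>lborel) \<partial>M) \<le> ennreal ((1/4)^k)"
    and S': "\<And>k. (\<integral>\<^sup>+w. ennreal ((norm (J' w - simple_integral B (n' k) (\<tau>' k) (\<xi>' k) s w))\<^sup>2) \<partial>M) \<le> ennreal ((1/4)^k)"
    using has_ito_integral_fast[OF J'] by blast
  define P where "P k = simple_process (n k) (\<tau> k) (\<xi> k)" for k
  define P' where "P' k = simple_process (n' k) (\<tau>' k) (\<xi>' k)" for k
  define I where "I k = simple_integral B (n k) (\<tau> k) (\<xi> k)" for k
  define I' where "I' k = simple_integral B (n' k) (\<tau>' k) (\<xi>' k)" for k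
  define e where "e k w = (\<integral>\<^sup>+r\<in>{0..t}. ennreal ((norm (H r w - P k r w))\<^sup>2) \<partial>lborel)" for k w
  define e' where "e' k w = (\<integral>\<^sup>+r\<in>{0..s}. ennreal ((norm (H r w - P' k r w))\<^sup>2) \<partial>lborel)" for k w
  define W where "W k w = (LINT r|lborel. indicator {0<..s} r * (norm (transpose (P k r w - P' k r w) *v ((2^k) *\<^sub>R \<theta>)))\<^sup>2)" for k w
  define V where "V k w = (LINT r|lborel. indicator {s<..t} r * (norm (transpose (P k r w) *v \<theta>))\<^sup>2)" for k w
  \<comment> \<open>Why \<open>2^k\<close>: after division by it, the bound \<open>Y k < 2^k\<close>
    contributes \<open>k ln 2 / 2^k\<close>, while the quadratic term, of order \<open>4^k\<close>
    times the L2 errors, shrinks to \<open>2^k\<close> times these errors. Both tend to 0.\<close>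
  define Y where "Y k w = exp (2^k * (\<theta> \<bullet> (I k s w - I' k s w)) - W k w / 2)" for k w
  define u where "u k w = exp (\<theta> \<bullet> (I k t w - I k s w) - V k w / 2)" for k w
  define c where "c = norm \<theta>"
  have Hm: "(\<lambda>(r, w). H r w) \<in> borel_measurable (restrict_space borel {0..t} \<Otimes>\<^sub>M F t)"
    and Hm': "(\<lambda>(r, w). H r w) \<in> borel_measurable (restrict_space borel {0..s} \<Otimes>\<^sub>M F s)"
    and Jm [measurable]: "J \<in> borel_measurable M" "J' \<in> borel_measurable M"
    using J J' by (auto simp: has_ito_integral_def)
  have em [measurable]: "e k \<in> borel_measurable M" "e' k \<in> borel_measurable M" for k
    using simple_approximation_error_measurable(1)[OF Hm t si] simple_approximation_error_measurable(1)[OF Hm' st(1) si']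
    by (simp_all add: e_def[abs_def] e'_def[abs_def] P_def P'_def)
  have er: "w \<in> space M \<Longrightarrow> (\<lambda>r. ennreal ((norm (H r w - P k r w))\<^sup>2) * indicator {0..t} r) \<in> borel_measurable borel"
    "w \<in> space M \<Longrightarrow> (\<lambda>r. ennreal ((norm (H r w - P' k r w))\<^sup>2) * indicator {0..s} r) \<in> borel_measurable borel" for k w
    using simple_approximation_error_measurable(2)[OF Hm t si] simple_approximation_error_measurable(2)[OF Hm' st(1) si']
    by (simp_all add: P_def P'_def)
  have Im [measurable]: "I k t \<in> borel_measurable M" "I' k s \<in> borel_measurable M" for k
    using simple_integral_measurable[OF si t] simple_integral_measurable[OF si' st(1)]
    by (simp_all add: I_def I'_def)
  have Ym [measurable]: "Y k \<in> borel_measurable M" and Y: "(\<integral>\<^sup>+w. ennreal (Y k w) \<partial>M) = 1" for k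
  proof -
    have I0: "I k 0 w = 0" "I' k 0 w = 0" for w
      by (simp_all add: I_def I'_def simple_integral_0[OF si] simple_integral_0[OF si'])
    note E = nn_integral_exp_simple_integral[OF si[of k] si'[of k], of 0 s "\<lambda>_. 1" "2^k *\<^sub>R \<theta>", folded P_def P'_def I_def I'_def]
    show "Y k \<in> borel_measurable M"
      using E(2) st by (simp add: Y_def[abs_def] W_def I0)
    show "(\<integral>\<^sup>+w. ennreal (Y k w) \<partial>M) = 1"
      using E(1) st by (simp add: Y_def W_def I0 emeasure_space_1)
  qed
  have um [measurable]: "u k \<in> borel_measurable M" and u: "(\<integral>\<^sup>+w. ennreal (f w) * ennreal (u k w) \<partial>M) = (\<integral>\<^sup>+w. ennreal (f w) \<partial>M)" for k
  proof -
    \<comment> \<open>The integrand with no cells leaves the exponential martingale of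
      \<open>P k\<close> alone.\<close>
    have si0: "simple_integrand F 0 (\<tau> k) (\<xi> k)" using si[of k] by (simp add: simple_integrand_def)
    have *: "simple_process 0 (\<tau> k) (\<xi> k) r w = 0" "simple_integral B 0 (\<tau> k) (\<xi> k) r w = 0" for r w
      by (simp_all add: simple_process_def simple_integral_def)
    note E = nn_integral_exp_simple_integral[OF si[of k] si0 st, of "\<lambda>w. ennreal (f w)" \<theta>, unfolded *, folded P_def I_def]
    show "u k \<in> borel_measurable M" using E(2) by (simp add: u_def[abs_def] V_def)
    show "(\<integral>\<^sup>+w. ennreal (f w) * ennreal (u k w) \<partial>M) = (\<integral>\<^sup>+w. ennreal (f w) \<partial>M)"
      using E(1) by (simp add: u_def V_def)
  qed
  have quad: "(norm (transpose A *v x))\<^sup>2 \<le> (norm x)\<^sup>2 * (norm A)\<^sup>2" for A :: "real^'n^'n" and x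
    using power_mono[OF norm_transpose_mult_le[of A x] norm_ge_zero, of 2] by (simp add: power_mult_distrib mult.commute)
  \<comment> \<open>On \<open>{0..s}\<close> both \<open>P k\<close> and \<open>P' k\<close>
    approximate \<open>H\<close>, so their distance is controlled through \<open>H\<close>.\<close>
  have W_le: "W k w / 2 \<le> 4^k * c\<^sup>2 * (enn2real (e k w) + enn2real (e' k w))"
    if w: "w \<in> space M" and fin: "e k w < \<infinity>" "e' k w < \<infinity>" for k w
  proof -
    let ?a = "2 * (4^k * c\<^sup>2)"
    have pt: "ennreal (indicator {0<..s} r * (norm (transpose (P k r w - P' k r w) *v ((2^k) *\<^sub>R \<theta>)))\<^sup>2)
      \<le> ennreal ?a * (ennreal ((norm (H r w - P k r w))\<^sup>2) * indicator {0..t} r)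
        + ennreal ?a * (ennreal ((norm (H r w - P' k r w))\<^sup>2) * indicator {0..s} r)" for r
    proof (cases "r \<in> {0<..s}")
      case True
      have "(norm (transpose (P k r w - P' k r w) *v ((2^k) *\<^sub>R \<theta>)))\<^sup>2 \<le> (norm ((2^k) *\<^sub>R \<theta>))\<^sup>2 * (norm (P k r w - P' k r w))\<^sup>2"
        by (rule quad)
      also have "\<dots> = 4^k * c\<^sup>2 * (norm ((H r w - P' k r w) + - (H r w - P k r w)))\<^sup>2"
        by (simp add: c_def power_mult_distrib power2_eq_square flip: power_mult_distrib)
      also have "\<dots> \<le> 4^k * c\<^sup>2 * (2 * (norm (H r w - P' k r w))\<^sup>2 + 2 * (norm (H r w - P k r w))\<^sup>2)"
        using power2_norm_add_le[of "H r w - P' k r w" "- (H r w - P k r w)"] by (intro mult_left_mono) (simp_all add: norm_minus_commute)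
      also have "\<dots> = ?a * (norm (H r w - P k r w))\<^sup>2 + ?a * (norm (H r w - P' k r w))\<^sup>2"
        by (simp add: algebra_simps)
      finally show ?thesis
        using True st by (simp flip: ennreal_mult ennreal_plus)
    qed simp
    have "ennreal (W k w) \<le> (\<integral>\<^sup>+r. ennreal (indicator {0<..s} r * (norm (transpose (P k r w - P' k r w) *v ((2^k) *\<^sub>R \<theta>)))\<^sup>2) \<partial>lborel)"
      unfolding W_def by (rule ennreal_integral_le_nn_integral) simp
    also have "\<dots> \<le> (\<integral>\<^sup>+r. ennreal ?a * (ennreal ((norm (H r w - P k r w))\<^sup>2) * indicator {0..t} r)
        + ennreal ?a * (ennreal ((norm (H r w - P' k r w))\<^sup>2) * indicator {0..s} r) \<partial>lborel)"
      by (intro nn_integral_mono pt)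
    also have "\<dots> = ennreal ?a * e k w + ennreal ?a * e' k w"
      unfolding e_def e'_def using er[OF w]
      by (subst nn_integral_add) (auto simp: nn_integral_cmult)
    also have "\<dots> = ennreal (?a * enn2real (e k w) + ?a * enn2real (e' k w))"
      using fin by (simp add: ennreal_plus ennreal_mult less_top)
    finally have "W k w \<le> ?a * enn2real (e k w) + ?a * enn2real (e' k w)"
      by (subst (asm) ennreal_le_iff) auto
    then show ?thesis by (simp add: algebra_simps)
  qed
  \<comment> \<open>Replacing \<open>P k\<close> by \<open>H\<close> under the square costs a factor
    2, which uses up the 1/2 of the exponential martingale and leaves
    \<open>\<kappa> * (t - s)\<close>.\<close>
  have V_le: "V k w / 2 \<le> \<kappa> * (t - s) + c\<^sup>2 * enn2real (e k w)"
    if w: "w \<in> space M" and fin: "e k w < \<infinity>" for k w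
  proof -
    have pt: "ennreal (indicator {s<..t} r * (norm (transpose (P k r w) *v \<theta>))\<^sup>2)
      \<le> ennreal (2 * \<kappa>) * indicator {s<..t} r + ennreal (2 * c\<^sup>2) * (ennreal ((norm (H r w - P k r w))\<^sup>2) * indicator {0..t} r)" for r
    proof (cases "r \<in> {s<..t}")
      case True
      have "transpose (P k r w) *v \<theta> = transpose (H r w) *v \<theta> + transpose (- (H r w - P k r w)) *v \<theta>"
        using linear_add[OF linear_transpose_mult, of "H r w" "- (H r w - P k r w)" \<theta>] by simp
      then have "(norm (transpose (P k r w) *v \<theta>))\<^sup>2 \<le> 2 * (norm (transpose (H r w) *v \<theta>))\<^sup>2 + 2 * (norm (transpose (- (H r w - P k r w)) *v \<theta>))\<^sup>2"
        using power2_norm_add_le by metis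
      also have "\<dots> \<le> 2 * \<kappa> + 2 * (c\<^sup>2 * (norm (- (H r w - P k r w)))\<^sup>2)"
        using \<kappa>[of r w] w True st unfolding c_def by (intro add_mono mult_left_mono quad) auto
      finally have "(norm (transpose (P k r w) *v \<theta>))\<^sup>2 \<le> 2 * \<kappa> + 2 * c\<^sup>2 * (norm (H r w - P k r w))\<^sup>2"
        by (simp add: norm_minus_commute)
      then show ?thesis
        using True st \<kappa>0 by (simp flip: ennreal_mult ennreal_plus)
    qed simp
    have "ennreal (V k w) \<le> (\<integral>\<^sup>+r. ennreal (indicator {s<..t} r * (norm (transpose (P k r w) *v \<theta>))\<^sup>2) \<partial>lborel)"
      unfolding V_def by (rule ennreal_integral_le_nn_integral) simp
    also have "\<dots> \<le> (\<integral>\<^sup>+r. ennreal (2 * \<kappa>) * indicator {s<..t} r + ennreal (2 * c\<^sup>2) * (ennreal ((norm (H r w - P k r w))\<^sup>2) * indicator {0..t} r) \<partial>lborel)"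
      by (intro nn_integral_mono pt)
    also have "\<dots> = ennreal (2 * \<kappa>) * ennreal (t - s) + ennreal (2 * c\<^sup>2) * e k w"
      unfolding e_def using er[OF w] st
      by (subst nn_integral_add) (auto simp: nn_integral_cmult nn_integral_cmult_indicator)
    also have "\<dots> = ennreal (2 * \<kappa> * (t - s) + 2 * c\<^sup>2 * enn2real (e k w))"
      using fin st \<kappa>0 by (simp add: ennreal_plus ennreal_mult less_top)
    finally have "V k w \<le> 2 * \<kappa> * (t - s) + 2 * c\<^sup>2 * enn2real (e k w)"
      using \<kappa>0 st by (subst (asm) ennreal_le_iff) auto
    then show ?thesis by simp
  qed
  have geo: "summable (\<lambda>k. (1/2::real)^k)" "summable (\<lambda>k. (1/4::real)^k)"
    by (auto intro!: summable_geometric)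
  have half: "ennreal (2^k) * x \<le> ennreal ((1/2)^k)" if "x \<le> ennreal ((1/4)^k)" for x :: ennreal and k
  proof -
    have "ennreal (2^k) * x \<le> ennreal (2^k) * ennreal ((1/4)^k)"
      using that by (rule mult_left_mono) simp
    also have "\<dots> = ennreal ((1/2)^k)"
      by (simp flip: ennreal_mult power_mult_distrib)
    finally show ?thesis .
  qed
  have Re: "(\<integral>\<^sup>+w. e k w \<partial>M) \<le> ennreal ((1/4)^k)" and Re': "(\<integral>\<^sup>+w. e' k w \<partial>M) \<le> ennreal ((1/4)^k)" for k
    using R R' by (simp_all add: e_def P_def e'_def P'_def)
  have A1: "AE w in M. (\<lambda>k. ennreal (2^k) * e k w) \<longlonglongrightarrow> 0"
    by (rule AE_tendsto_0_of_summable_nn_integral[OF _ _ _ geo(1)])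
      (use half Re in \<open>auto simp: nn_integral_cmult\<close>)
  have A2: "AE w in M. (\<lambda>k. ennreal (2^k) * e' k w) \<longlonglongrightarrow> 0"
    by (rule AE_tendsto_0_of_summable_nn_integral[OF _ _ _ geo(1)])
      (use half Re' in \<open>auto simp: nn_integral_cmult\<close>)
  have A3: "AE w in M. (\<lambda>k. ennreal ((norm (J w - I k t w))\<^sup>2)) \<longlonglongrightarrow> 0"
    by (rule AE_tendsto_0_of_summable_nn_integral[OF _ _ _ geo(2)]) (use S[folded I_def] in auto)
  have A4: "AE w in M. (\<lambda>k. ennreal ((norm (J' w - I' k s w))\<^sup>2)) \<longlonglongrightarrow> 0"
    by (rule AE_tendsto_0_of_summable_nn_integral[OF _ _ _ geo(2)]) (use S'[folded I'_def] in auto)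
  have A5: "AE w in M. (\<lambda>k. ennreal ((1/2)^k) * ennreal (Y k w)) \<longlonglongrightarrow> 0"
    by (rule AE_tendsto_0_of_summable_nn_integral[OF _ _ _ geo(1)]) (auto simp: nn_integral_cmult Y)
  have main: "AE w in M. ennreal (f w * exp (\<theta> \<bullet> (J w - J' w) - \<kappa> * (t - s))) \<le> liminf (\<lambda>k. ennreal (f w) * ennreal (u k w))"
    using A1 A2 A3 A4 A5 AE_space
  proof eventually_elim
    case (elim w)
    \<comment> \<open>The exponent of \<open>u k\<close> contains \<open>I k s\<close>, whose limit
      is not given. In \<open>z k\<close> it is replaced by \<open>I' k s\<close>, which tends to
      \<open>J'\<close>, and every error is subtracted: \<open>z k\<close> bounds the exponent from
      below and converges to the desired one.\<close>
    define z where "z k = \<theta> \<bullet> (I k t w - I' k s w) - real k * ln 2 / 2^k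
       - c\<^sup>2 * (enn2real (ennreal (2^k) * e k w) + enn2real (ennreal (2^k) * e' k w))
       - \<kappa> * (t - s) - c\<^sup>2 * (enn2real (ennreal (2^k) * e k w) / 2^k)" for k
    have lim0: "(\<lambda>k. enn2real (g k)) \<longlonglongrightarrow> 0" if "g \<longlonglongrightarrow> 0" for g :: "nat \<Rightarrow> ennreal"
      using tendsto_enn2real[of g 0] that by simp
    have limv: "X \<longlonglongrightarrow> j" if "(\<lambda>k. ennreal ((norm (j - X k))\<^sup>2)) \<longlonglongrightarrow> 0" for X :: "nat \<Rightarrow> real^'n" and j
    proof -
      have "(\<lambda>k. (norm (j - X k))\<^sup>2) \<longlonglongrightarrow> 0" using lim0[OF that] by simp
      then have "(\<lambda>k. sqrt ((norm (j - X k))\<^sup>2)) \<longlonglongrightarrow> sqrt 0" by (rule tendsto_real_sqrt)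
      then have "(\<lambda>k. norm (X k - j)) \<longlonglongrightarrow> 0" by (simp add: norm_minus_commute)
      then show ?thesis using LIM_zero_cancel tendsto_norm_zero_iff by blast
    qed
    \<comment> \<open>This excludes infinite errors, which \<open>enn2real\<close> would silently
      turn into 0.\<close>
    have finI: "x < top" if "ennreal (2^k) * x < 1" for x :: ennreal and k
      using that by (cases x) (auto simp: ennreal_mult_top)
    have k2: "(\<lambda>k. real k * ln 2 / 2^k) \<longlonglongrightarrow> 0" "(\<lambda>k. (1 / 2^k :: real)) \<longlonglongrightarrow> 0"
    proof -
      have "(\<lambda>k. ln 2 * (real k / 2^k)) \<longlonglongrightarrow> ln 2 * 0"
        by (intro tendsto_mult tendsto_const lim_n_over_pown) simp
      then show "(\<lambda>k. real k * ln 2 / 2^k) \<longlonglongrightarrow> 0" by (simp add: mult.commute)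
      show "(\<lambda>k. (1 / 2^k :: real)) \<longlonglongrightarrow> 0"
        using LIMSEQ_power_zero[of "1/2::real"] by (simp add: power_divide)
    qed
    have "z \<longlonglongrightarrow> \<theta> \<bullet> (J w - J' w) - 0 - c\<^sup>2 * (0 + 0) - \<kappa> * (t - s) - c\<^sup>2 * (0 * 0)"
      unfolding z_def[abs_def] divide_inverse[of "enn2real _"] inverse_eq_divide
      by (intro tendsto_intros limv lim0 k2 elim)
    then have "(\<lambda>k. ennreal (f w * exp (z k))) \<longlonglongrightarrow> ennreal (f w * exp (\<theta> \<bullet> (J w - J' w) - \<kappa> * (t - s)))"
      by (intro tendsto_intros) simp
    then have "ennreal (f w * exp (\<theta> \<bullet> (J w - J' w) - \<kappa> * (t - s))) = liminf (\<lambda>k. ennreal (f w * exp (z k)))"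
      by (simp add: lim_imp_Liminf)
    also have "\<dots> \<le> liminf (\<lambda>k. ennreal (f w) * ennreal (u k w))"
    proof (rule Liminf_mono)
      have "\<forall>\<^sub>F k in sequentially. ennreal (2^k) * e k w < 1" "\<forall>\<^sub>F k in sequentially. ennreal (2^k) * e' k w < 1"
        "\<forall>\<^sub>F k in sequentially. ennreal ((1/2)^k) * ennreal (Y k w) < 1"
        by (rule order_tendstoD(2)[OF elim(1)] order_tendstoD(2)[OF elim(2)] order_tendstoD(2)[OF elim(5)]; simp)+
      then show "\<forall>\<^sub>F k in sequentially. ennreal (f w * exp (z k)) \<le> ennreal (f w) * ennreal (u k w)"
      proof eventually_elim
        case (elim k)
        have fin: "e k w < \<infinity>" "e' k w < \<infinity>"
          using elim(1,2) by (auto intro!: finI)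
        define r where "r = enn2real (e k w)"
        define r' where "r' = enn2real (e' k w)"
        have rr: "enn2real (ennreal (2^k) * e k w) = 2^k * r" "enn2real (ennreal (2^k) * e' k w) = 2^k * r'"
          by (simp_all add: r_def r'_def enn2real_mult)
        have "(1/2)^k * Y k w < 1"
          using elim(3) by (simp add: Y_def ennreal_less_one_iff flip: ennreal_mult)
        then have "2^k * ((1/2)^k * Y k w) < 2^k"
          by (metis mult.right_neutral mult_strict_left_mono zero_less_numeral zero_less_power)
        then have "Y k w < exp (real k * ln 2)"
          by (simp add: exp_of_nat_mult flip: mult.assoc power_mult_distrib)
        then have "2^k * (\<theta> \<bullet> (I k s w - I' k s w)) - W k w / 2 < real k * ln 2"
          unfolding Y_def by (simp only: exp_less_cancel_iff)
        then have "2^k * (\<theta> \<bullet> (I k s w - I' k s w)) \<le> real k * ln 2 + 4^k * c\<^sup>2 * (r + r')"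
          using W_le[OF \<open>w \<in> space M\<close> fin] unfolding r_def r'_def by linarith
        also have "\<dots> = 2^k * (real k * ln 2 / 2^k + c\<^sup>2 * (2^k * r + 2^k * r'))"
        proof -
          have "(4::real)^k = 2^k * 2^k" by (simp flip: power_mult_distrib)
          then show ?thesis by (simp add: distrib_left distrib_right mult_ac)
        qed
        finally have D: "\<theta> \<bullet> (I k s w - I' k s w) \<le> real k * ln 2 / 2^k + c\<^sup>2 * (2^k * r + 2^k * r')"
          by (simp only: mult_le_cancel_left_pos zero_less_power zero_less_numeral)
        have "z k \<le> \<theta> \<bullet> (I k t w - I k s w) - V k w / 2"
        proof -
          have "\<theta> \<bullet> (I k t w - I k s w) = \<theta> \<bullet> (I k t w - I' k s w) - \<theta> \<bullet> (I k s w - I' k s w)"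
            by (simp add: inner_diff_right)
          moreover have "z k = \<theta> \<bullet> (I k t w - I' k s w) - real k * ln 2 / 2^k - c\<^sup>2 * (2^k * r + 2^k * r')
              - \<kappa> * (t - s) - c\<^sup>2 * r"
            unfolding z_def rr by simp
          moreover have "V k w / 2 \<le> \<kappa> * (t - s) + c\<^sup>2 * r"
            using V_le[OF \<open>w \<in> space M\<close> fin(1)] by (simp only: r_def)
          ultimately show ?thesis using D by linarith
        qed
        then have "f w * exp (z k) \<le> f w * u k w"
          unfolding u_def using f0 by (intro mult_left_mono) auto
        then show ?case
          using f0[of w] by (simp add: u_def ennreal_leI flip: ennreal_mult)
      qed
    qed
    finally show ?case .
  qed
  have "(\<integral>\<^sup>+w. ennreal (f w * exp (\<theta> \<bullet> (J w - J' w) - \<kappa> * (t - s))) \<partial>M) \<le> (\<integral>\<^sup>+w. liminf (\<lambda>k. ennreal (f w) * ennreal (u k w)) \<partial>M)"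
    by (rule nn_integral_mono_AE[OF main])
  also have "\<dots> \<le> liminf (\<lambda>k. \<integral>\<^sup>+w. ennreal (f w) * ennreal (u k w) \<partial>M)"
    by (rule nn_integral_liminf) simp
  also have "\<dots> = (\<integral>\<^sup>+w. ennreal (f w) \<partial>M)"
    by (simp add: u Liminf_const)
  finally show ?thesis .
qed

end

section \<open>Maximal inequality for a diffusion with a drift\<close>

text \<open>Doob's maximal inequality for nonnegative supermartingales, with the supermartingale
  property stated on events of the past instead of through conditional expectations.\<close>

lemma maximal_inequality:
  fixes Z :: "nat \<Rightarrow> 's \<Rightarrow> ennreal"
  assumes Z: "\<And>j. Z j \<in> borel_measurable (G j)"
    and G: "\<And>j. subalgebra M (G j)" "\<And>i j. i \<le> j \<Longrightarrow> sets (G i) \<subseteq> sets (G j)"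
    and super: "\<And>j A. A \<in> sets (G j) \<Longrightarrow>
      (\<integral>\<^sup>+w. Z (Suc j) w * indicator A w \<partial>M) \<le> (\<integral>\<^sup>+w. Z j w * indicator A w \<partial>M)"
  shows "c * emeasure M {w \<in> space M. \<exists>i<m. c \<le> Z i w} \<le> (\<integral>\<^sup>+w. Z 0 w \<partial>M)"
proof -
  define A where "A m = {w \<in> space M. \<forall>i<m. Z i w < c}" for m
  define D where "D m = {w \<in> space M. \<exists>i<m. c \<le> Z i w}" for m
  have sp: "space (G j) = space M" for j using G(1) by (simp add: subalgebra_def)
  have ZG: "Z i \<in> borel_measurable (G j)" if "i \<le> j" for i j
    using Z[of i] G(2)[OF that] sp by (auto simp: measurable_def)
  have ZM [measurable]: "Z i \<in> borel_measurable M" for i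
    using Z[of i] G(1)[of i] by (auto simp: measurable_def subalgebra_def)
  have AS: "A (Suc m) \<in> sets (G m)" for m
  proof -
    have "Measurable.pred (G m) (\<lambda>w. \<forall>i\<in>{..<Suc m}. Z i w < c)"
    proof (rule pred_intros_finite)
      fix i assume "i \<in> {..<Suc m}"
      then have [measurable]: "Z i \<in> borel_measurable (G m)" using ZG by simp
      show "Measurable.pred (G m) (\<lambda>w. Z i w < c)" by measurable
    qed simp
    moreover have "A (Suc m) = {w \<in> space (G m). \<forall>i\<in>{..<Suc m}. Z i w < c}"
      unfolding A_def sp by blast
    ultimately show ?thesis by (simp only: pred_def)
  qed
  have AM [measurable]: "A m \<in> sets M" and DM [measurable]: "D m \<in> sets M" for m
    unfolding A_def D_def by measurable
  \<comment> \<open>The claim is strengthened by the mass still carried by the paths that have not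
    reached \<open>c\<close>; this makes it inductive.\<close>
  have "c * emeasure M (D m) + (\<integral>\<^sup>+w. Z m w * indicator (A m) w \<partial>M) \<le> (\<integral>\<^sup>+w. Z 0 w \<partial>M)"
  proof (induction m)
    case 0
    show ?case by (simp add: A_def D_def)
  next
    case (Suc m)
    \<comment> \<open>These paths reach \<open>c\<close> first at index \<open>m\<close>. There
      \<open>Z m\<close> pays for \<open>c\<close>; on the rest of \<open>A m\<close>, an event of
      \<open>G m\<close>, the supermartingale step applies.\<close>
    define C where "C = A m \<inter> {w \<in> space M. c \<le> Z m w}"
    have CM [measurable]: "C \<in> sets M" unfolding C_def by measurable
    have D: "D (Suc m) = D m \<union> C" "D m \<inter> C = {}"
      by (auto simp: A_def D_def C_def less_Suc_eq)
    have A: "indicator (A m) w = (indicator C w + indicator (A (Suc m)) w :: ennreal)" for w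
      by (auto simp: A_def C_def less_Suc_eq not_le indicator_def)
    have "c * emeasure M (D (Suc m)) + (\<integral>\<^sup>+w. Z (Suc m) w * indicator (A (Suc m)) w \<partial>M)
      \<le> c * emeasure M (D m) + c * emeasure M C + (\<integral>\<^sup>+w. Z m w * indicator (A (Suc m)) w \<partial>M)"
      using super[OF AS[of m]] D by (intro add_mono) (simp_all add: plus_emeasure[symmetric] distrib_left)
    also have "\<dots> = c * emeasure M (D m) + ((\<integral>\<^sup>+w. c * indicator C w \<partial>M) + (\<integral>\<^sup>+w. Z m w * indicator (A (Suc m)) w \<partial>M))"
      by (simp add: nn_integral_cmult_indicator add.assoc)
    also have "\<dots> \<le> c * emeasure M (D m) + ((\<integral>\<^sup>+w. Z m w * indicator C w \<partial>M) + (\<integral>\<^sup>+w. Z m w * indicator (A (Suc m)) w \<partial>M))"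
      by (intro add_mono order_refl nn_integral_mono) (auto simp: C_def indicator_def)
    also have "\<dots> = c * emeasure M (D m) + (\<integral>\<^sup>+w. Z m w * indicator (A m) w \<partial>M)"
      unfolding A distrib_left by (subst nn_integral_add) auto
    also have "\<dots> \<le> (\<integral>\<^sup>+w. Z 0 w \<partial>M)"
      by (rule Suc.IH)
    finally show ?case .
  qed
  then show ?thesis
    unfolding D_def by (rule order_trans[rotated]) simp
qed

section \<open>A diffusion with a drift along one direction\<close>

locale drifting_sde =
  fixes a :: "real ^ 'n \<Rightarrow> real ^ 'n ^ 'n" and c :: "real ^ 'n \<Rightarrow> real ^ 'n" and x u :: "real ^ 'n"
    and M :: "'s measure" and F B X and \<nu> \<delta> :: real
  assumes solution: "sde_solution a c x M F B X"
    and drift_continuous: "continuous_on UNIV c"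
    and drift: "\<And>y. \<delta> \<le> c y \<bullet> u"
    and diffusion: "\<And>y. (norm (transpose (a y) *v u))\<^sup>2 \<le> \<nu>"
    and pos: "0 < \<nu>" "0 < \<delta>"
begin

sublocale filtered_brownian_motion M F B
proof -
  note sol = solution[unfolded sde_solution_def]
  have sub: "\<forall>t\<ge>0. subalgebra M (F t)"
    by (rule sol[THEN conjunct2, THEN conjunct2, THEN conjunct1])
  show "filtered_brownian_motion M F B"
  proof (rule filtered_brownian_motion.intro)
    show "prob_space M"
      by (rule sol[THEN conjunct1])
    show "filtered_brownian_motion_axioms M F B"
    proof (rule filtered_brownian_motion_axioms.intro)
      show "filtration (space M) F"
        by (rule sol[THEN conjunct2, THEN conjunct1])
      show "brownian_motion M F B"
        by (rule sol[THEN conjunct2, THEN conjunct2, THEN conjunct2, THEN conjunct1])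
      show "subalgebra M (F t)" if "0 \<le> t" for t
        using sub that by blast
    qed
  qed
qed

lemma X_measurable:
  assumes "0 \<le> s" "s \<le> t"
  shows "X s \<in> borel_measurable (F t)"
proof -
  have "\<forall>t\<ge>0. X t \<in> borel_measurable (F t)"
    using solution unfolding sde_solution_def by (elim conjE)
  then have "X s \<in> borel_measurable (F s)"
    using assms(1) by (elim allE[of _ s] impE)
  then show ?thesis
    by (rule measurable_F_mono[OF assms(2)])
qed

lemma X_continuous: "w \<in> space M \<Longrightarrow> continuous_on {0..} (\<lambda>t. X t w)"
proof -
  have "\<forall>w\<in>space M. continuous_on {0..} (\<lambda>t. X t w)"
    using solution unfolding sde_solution_def by (elim conjE)
  then show "w \<in> space M \<Longrightarrow> continuous_on {0..} (\<lambda>t. X t w)" by simp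
qed

lemma drift_integral:
  assumes st: "0 \<le> s" "s \<le> t" and w: "w \<in> space M"
  shows "\<delta> * (t - s) \<le> (integral {0..t} (\<lambda>r. c (X r w)) - integral {0..s} (\<lambda>r. c (X r w))) \<bullet> u"
proof -
  have cont: "continuous_on {0..} (\<lambda>r. c (X r w))"
    using continuous_on_compose2[OF drift_continuous X_continuous[OF w]] by simp
  have int: "(\<lambda>r. c (X r w)) integrable_on {p..q}" if "0 \<le> p" for p q
    using that by (intro integrable_continuous_interval continuous_on_subset[OF cont]) auto
  have "integral {0..s} (\<lambda>r. c (X r w)) + integral {s..t} (\<lambda>r. c (X r w)) = integral {0..t} (\<lambda>r. c (X r w))"
    using st int by (intro Henstock_Kurzweil_Integration.integral_combine) auto
  then have "integral {0..t} (\<lambda>r. c (X r w)) - integral {0..s} (\<lambda>r. c (X r w)) = integral {s..t} (\<lambda>r. c (X r w))"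
    by (simp add: algebra_simps)
  then have "(integral {0..t} (\<lambda>r. c (X r w)) - integral {0..s} (\<lambda>r. c (X r w))) \<bullet> u = integral {s..t} (\<lambda>r. c (X r w)) \<bullet> u"
    by simp
  also have "\<dots> = integral {s..t} (\<lambda>r. c (X r w) \<bullet> u)"
    using integral_linear[OF int[OF st(1), of t] bounded_linear_inner_left[of u]] by (simp only: o_def)
  also have "\<dots> \<ge> integral {s..t} (\<lambda>r. \<delta>)"
  proof (rule integral_le)
    show "(\<lambda>r. c (X r w) \<bullet> u) integrable_on {s..t}"
      using integrable_linear[OF int[OF st(1), of t] bounded_linear_inner_left[of u]] by (simp only: o_def)
  qed (use drift in auto)
  also have "integral {s..t} (\<lambda>r. \<delta>) = \<delta> * (t - s)"
    using integral_const_real[of s t \<delta>] st by (simp only: content_real mult.commute real_scaleR_def)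
  finally show ?thesis .
qed

text \<open>
  With this rate the drift term \<open>\<gamma> \<delta>\<close> pays for \<open>\<gamma>\<^sup>2 \<nu>\<close>, twice the Ito correction; the factor 2
  absorbs the crude bound \<open>\<bar>x + y\<bar>\<^sup>2 \<le> 2 \<bar>x\<bar>\<^sup>2 + 2 \<bar>y\<bar>\<^sup>2\<close> used in the approximation.
\<close>

definition \<gamma> :: real where "\<gamma> = \<delta> / \<nu>"

lemma \<gamma>_pos: "0 < \<gamma>"
  using pos by (simp add: \<gamma>_def)

lemma X_0: "AE w in M. X 0 w = x"
  using solution unfolding sde_solution_def by (elim conjE)

lemma ito_decomposition:
  assumes "0 \<le> t"
  obtains J where "has_ito_integral M F B (\<lambda>r w. a (X r w)) t J"
    "AE w in M. X t w = x + J w + integral {0..t} (\<lambda>r. c (X r w))"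
proof -
  have "\<forall>t\<ge>0. \<exists>J. has_ito_integral M F B (\<lambda>s w. a (X s w)) t J \<and>
        (AE w in M. X t w = x + J w + integral {0..t} (\<lambda>s. c (X s w)))"
    using solution unfolding sde_solution_def by (elim conjE)
  from this[rule_format, OF assms] show thesis using that by (elim exE conjE)
qed

text \<open>With \<open>\<theta> = - \<gamma> *\<^sub>R u\<close>, the drift lowers the exponent by
  at least \<open>\<gamma> * \<delta> * (t - s)\<close>, exactly the compensator that the Ito
  estimate requires for \<open>\<kappa> = \<gamma> * \<delta>\<close>.\<close>

lemma nn_integral_exp_increment_le:
  assumes st: "0 \<le> s" "s \<le> t"
    and f: "f \<in> borel_measurable (F s)" and f0: "\<And>w. 0 \<le> f w"
  shows "(\<integral>\<^sup>+w. ennreal (f w * exp (- \<gamma> * ((X t w - X s w) \<bullet> u))) \<partial>M) \<le> (\<integral>\<^sup>+w. ennreal (f w) \<partial>M)"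
proof -
  have "0 \<le> t" using st by simp
  then obtain J where J: "has_ito_integral M F B (\<lambda>r w. a (X r w)) t J"
      "AE w in M. X t w = x + J w + integral {0..t} (\<lambda>r. c (X r w))"
    by (rule ito_decomposition)
  obtain J' where J': "has_ito_integral M F B (\<lambda>r w. a (X r w)) s J'"
      "AE w in M. X s w = x + J' w + integral {0..s} (\<lambda>r. c (X r w))"
    using st(1) by (rule ito_decomposition)
  have \<kappa>: "(norm (transpose (a (X r w)) *v (- \<gamma> *\<^sub>R u)))\<^sup>2 \<le> \<gamma> * \<delta>" for r w
  proof -
    have "(norm (transpose (a (X r w)) *v (- \<gamma> *\<^sub>R u)))\<^sup>2 = \<gamma>\<^sup>2 * (norm (transpose (a (X r w)) *v u))\<^sup>2"
      unfolding matrix_vector_mult_scaleR by (simp add: power_mult_distrib)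
    also have "\<dots> \<le> \<gamma>\<^sup>2 * \<nu>"
      by (intro mult_left_mono diffusion) simp
    also have "\<dots> = \<gamma> * \<delta>"
      using pos by (simp add: \<gamma>_def power2_eq_square)
    finally show ?thesis .
  qed
  have "(\<integral>\<^sup>+w. ennreal (f w * exp (- \<gamma> * ((X t w - X s w) \<bullet> u))) \<partial>M)
     \<le> (\<integral>\<^sup>+w. ennreal (f w * exp ((- \<gamma> *\<^sub>R u) \<bullet> (J w - J' w) - \<gamma> * \<delta> * (t - s))) \<partial>M)"
  proof (rule nn_integral_mono_AE)
    show "AE w in M. ennreal (f w * exp (- \<gamma> * ((X t w - X s w) \<bullet> u)))
       \<le> ennreal (f w * exp ((- \<gamma> *\<^sub>R u) \<bullet> (J w - J' w) - \<gamma> * \<delta> * (t - s)))"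
      using J(2) J'(2) AE_space
    proof eventually_elim
      case (elim w)
      define d where "d = integral {0..t} (\<lambda>r. c (X r w)) - integral {0..s} (\<lambda>r. c (X r w))"
      have "X t w - X s w = (J w - J' w) + d"
        unfolding d_def elim(1,2) by simp
      then have "- \<gamma> * ((X t w - X s w) \<bullet> u) = (- \<gamma> *\<^sub>R u) \<bullet> (J w - J' w) - \<gamma> * (d \<bullet> u)"
        by (simp only: inner_add_left inner_scaleR_left distrib_left inner_commute[of u])
      also have "\<dots> \<le> (- \<gamma> *\<^sub>R u) \<bullet> (J w - J' w) - \<gamma> * (\<delta> * (t - s))"
        using drift_integral[OF st elim(3)] \<gamma>_pos unfolding d_def
        by (intro diff_left_mono mult_left_mono) auto
      finally show ?case
        using f0 by (intro ennreal_leI mult_left_mono) (auto simp: mult.assoc)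
    qed
  qed
  also have "\<dots> \<le> (\<integral>\<^sup>+w. ennreal (f w) \<partial>M)"
    by (rule nn_integral_exp_ito_increment[OF st J(1) J'(1) \<kappa> f f0])
  finally show ?thesis .
qed

text \<open>On the grid, being below \<open>- y\<close> means that
  \<open>exp (- \<gamma> * (X \<bullet> u))\<close> has reached \<open>exp (\<gamma> * y)\<close>,
  and this supermartingale starts at 1. The bound depends neither on the mesh nor on the number of
  grid points.\<close>

lemma emeasure_grid_below:
  assumes x: "x = 0" and h: "0 < h"
  shows "emeasure M {w \<in> space M. \<exists>j<m. X (real j * h) w \<bullet> u \<le> - y} \<le> ennreal (exp (- \<gamma> * y))"
proof -
  define Z where "Z j w = exp (- \<gamma> * (X (real j * h) w \<bullet> u))" for j w
  have t0: "0 \<le> real j * h" for j using h by simp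
  have Zm: "(\<lambda>w. Z j w) \<in> borel_measurable (F (real j * h))" for j
  proof -
    have [measurable]: "X (real j * h) \<in> borel_measurable (F (real j * h))"
      using X_measurable[OF t0 order_refl] .
    show ?thesis unfolding Z_def by measurable
  qed
  have "ennreal (exp (\<gamma> * y)) * emeasure M {w \<in> space M. \<exists>j<m. ennreal (exp (\<gamma> * y)) \<le> ennreal (Z j w)} \<le> (\<integral>\<^sup>+w. ennreal (Z 0 w) \<partial>M)"
  proof (rule maximal_inequality[where G = "\<lambda>j. F (real j * h)"])
    show "(\<lambda>w. ennreal (Z j w)) \<in> borel_measurable (F (real j * h))" for j
      using Zm by simp
    show "subalgebra M (F (real j * h))" for j
      using subalg[OF t0] .
    show "sets (F (real i * h)) \<subseteq> sets (F (real j * h))" if "i \<le> j" for i j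
      using filtration h that unfolding filtration_def by (simp add: mult_right_mono)
    fix j A assume A: "A \<in> sets (F (real j * h))"
    have le: "real j * h \<le> real (Suc j) * h" using h by simp
    \<comment> \<open>The past value \<open>Z j\<close> and the event \<open>A\<close> together form
      the weight of the increment estimate.\<close>
    have "(\<integral>\<^sup>+w. ennreal (Z (Suc j) w) * indicator A w \<partial>M) =
       (\<integral>\<^sup>+w. ennreal (Z j w * indicator A w * exp (- \<gamma> * ((X (real (Suc j) * h) w - X (real j * h) w) \<bullet> u))) \<partial>M)"
      by (intro nn_integral_cong)
        (auto simp: indicator_def Z_def inner_diff_left algebra_simps simp flip: exp_add)
    also have "\<dots> \<le> (\<integral>\<^sup>+w. ennreal (Z j w * indicator A w) \<partial>M)"
      using Zm A by (intro nn_integral_exp_increment_le[OF t0 le]) (auto simp: Z_def)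
    also have "\<dots> = (\<integral>\<^sup>+w. ennreal (Z j w) * indicator A w \<partial>M)"
      by (intro nn_integral_cong) (simp add: indicator_def)
    finally show "(\<integral>\<^sup>+w. ennreal (Z (Suc j) w) * indicator A w \<partial>M) \<le> (\<integral>\<^sup>+w. ennreal (Z j w) * indicator A w \<partial>M)" .
  qed
  also have "(\<integral>\<^sup>+w. ennreal (Z 0 w) \<partial>M) = (\<integral>\<^sup>+w. 1 \<partial>M)"
  proof (rule nn_integral_cong_AE)
    show "AE w in M. ennreal (Z 0 w) = 1"
      using X_0 by eventually_elim (simp add: Z_def x)
  qed
  also have "{w \<in> space M. \<exists>j<m. ennreal (exp (\<gamma> * y)) \<le> ennreal (Z j w)} = {w \<in> space M. \<exists>j<m. X (real j * h) w \<bullet> u \<le> - y}"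
    (is "_ = ?S")
  proof -
    have "ennreal (exp (\<gamma> * y)) \<le> ennreal (Z j w) \<longleftrightarrow> X (real j * h) w \<bullet> u \<le> - y" for j w
    proof -
      have "ennreal (exp (\<gamma> * y)) \<le> ennreal (Z j w) \<longleftrightarrow> \<gamma> * y \<le> \<gamma> * (- (X (real j * h) w \<bullet> u))"
        by (simp add: Z_def)
      also have "\<dots> \<longleftrightarrow> y \<le> - (X (real j * h) w \<bullet> u)"
        using \<gamma>_pos by (rule mult_le_cancel_left_pos)
      finally show ?thesis by linarith
    qed
    then show ?thesis by simp
  qed
  finally have le: "ennreal (exp (\<gamma> * y)) * emeasure M ?S \<le> 1"
    by (simp add: emeasure_space_1)
  have "emeasure M ?S = ennreal (exp (- \<gamma> * y)) * (ennreal (exp (\<gamma> * y)) * emeasure M ?S)"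
    by (simp flip: mult.assoc ennreal_mult exp_add)
  also have "\<dots> \<le> ennreal (exp (- \<gamma> * y)) * 1"
    by (intro mult_left_mono le) simp
  finally show ?thesis by simp
qed

text \<open>The event ranges over uncountably many times, so it is enclosed in a measurable event
  about dyadic times. By continuity a path that is at \<open>- y\<close> is below
  \<open>- (y / 2)\<close> at a nearby dyadic time.\<close>

lemma emeasure_ever_below:
  assumes x: "x = 0" and y: "0 < y"
  shows "\<exists>A\<in>sets M. {w \<in> space M. \<exists>t\<ge>0. X t w \<bullet> u \<le> - y} \<subseteq> A \<and> emeasure M A \<le> ennreal (exp (- \<gamma> * (y / 2)))"
proof -
  \<comment> \<open>Mesh \<open>1 / 2^m\<close> and \<open>4^m\<close> cells give the horizon
    \<open>2^m\<close>: the grids become finer and longer at once.\<close>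
  define A where "A m = {w \<in> space M. \<exists>j<Suc (4 ^ m). X (real j * (1 / 2 ^ m)) w \<bullet> u \<le> - (y / 2)}" for m
  have Xm: "X t \<in> borel_measurable M" if "0 \<le> t" for t
    using measurable_from_F[OF that X_measurable[OF that order_refl]] .
  have AM: "A m \<in> sets M" for m
  proof -
    have "X (real j * (1 / 2 ^ m)) \<in> borel_measurable M" for j
      by (rule Xm) simp
    note [measurable] = this
    show ?thesis unfolding A_def by measurable
  qed
  \<comment> \<open>The grids are nested: index \<open>j\<close> becomes \<open>2 * j\<close> at the
    next level.\<close>
  have inc: "incseq A"
  proof (rule incseq_SucI, rule subsetI)
    fix m w assume "w \<in> A m"
    then obtain j where w: "w \<in> space M" and j: "j < Suc (4 ^ m)" "X (real j * (1 / 2 ^ m)) w \<bullet> u \<le> - (y / 2)"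
      unfolding A_def by blast
    have "2 * j < Suc (4 ^ Suc m)" using j(1) by simp
    moreover have "real (2 * j) * (1 / 2 ^ Suc m) = real j * (1 / 2 ^ m)" by simp
    ultimately show "w \<in> A (Suc m)"
      unfolding A_def using w j(2) by (intro CollectI conjI exI[of _ "2 * j"]) simp_all
  qed
  have "emeasure M (\<Union>m. A m) = (SUP m. emeasure M (A m))"
    using AM inc by (intro SUP_emeasure_incseq[symmetric]) auto
  also have "\<dots> \<le> ennreal (exp (- \<gamma> * (y / 2)))"
    unfolding A_def by (intro SUP_least emeasure_grid_below x) simp
  finally have le: "emeasure M (\<Union>m. A m) \<le> ennreal (exp (- \<gamma> * (y / 2)))" .
  have sub: "{w \<in> space M. \<exists>t\<ge>0. X t w \<bullet> u \<le> - y} \<subseteq> (\<Union>m. A m)"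
  proof safe
    fix w t assume w: "w \<in> space M" and t: "0 \<le> (t::real)" "X t w \<bullet> u \<le> - y"
    have "continuous_on {0..} (\<lambda>t. X t w \<bullet> u)"
      by (intro continuous_intros X_continuous w)
    from this[unfolded continuous_on_iff, rule_format, of t "y / 2"] t(1) y
    obtain d where d: "0 < d" "\<And>s. 0 \<le> s \<Longrightarrow> dist s t < d \<Longrightarrow> dist (X s w \<bullet> u) (X t w \<bullet> u) < y / 2"
      by (auto simp: atLeast_iff)
    \<comment> \<open>Since \<open>m < 2^m\<close>, this puts \<open>t\<close> before the horizon
      and makes the mesh smaller than \<open>d\<close>.\<close>
    obtain m :: nat where m: "max t (1 / d) < real m"
      using reals_Archimedean2 by blast
    have m2: "real m < 2 ^ m"
      by (rule of_nat_less_two_power)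
    define j where "j = nat \<lfloor>t * 2 ^ m\<rfloor>"
    have j: "real j \<le> t * 2 ^ m" "t * 2 ^ m < real j + 1"
      using t(1) unfolding j_def by (auto simp: of_nat_nat)
    have "real j \<le> 2 ^ m * 2 ^ m"
    proof -
      have "t \<le> 2 ^ m" using m m2 by linarith
      then have "t * 2 ^ m \<le> 2 ^ m * 2 ^ m" by (intro mult_right_mono) auto
      then show ?thesis using j(1) by linarith
    qed
    then have "real j \<le> 4 ^ m" by (simp flip: power_mult_distrib)
    then have j4: "j < Suc (4 ^ m)"
      using of_nat_le_iff[of j "4 ^ m", where 'a = real] by (simp only: less_Suc_eq_le of_nat_power of_nat_numeral)
    have "dist (real j * (1 / 2 ^ m)) t < d"
    proof -
      have "1 / d < 2 ^ m" using m m2 by linarith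
      then have "1 < d * 2 ^ m" using d(1) by (simp add: field_simps)
      moreover have "real j * (1 / 2 ^ m) \<le> t" using j(1) by (simp add: field_simps)
      moreover have "t < real j * (1 / 2 ^ m) + 1 / 2 ^ m" using j(2) by (simp add: field_simps)
      moreover have "1 / 2 ^ m < d" using \<open>1 < d * 2 ^ m\<close> by (simp add: field_simps)
      ultimately show ?thesis by (simp add: dist_real_def)
    qed
    then have "dist (X (real j * (1 / 2 ^ m)) w \<bullet> u) (X t w \<bullet> u) < y / 2"
      by (intro d(2)) simp
    then have "X (real j * (1 / 2 ^ m)) w \<bullet> u \<le> - (y / 2)"
      using t(2) unfolding dist_real_def by linarith
    then show "w \<in> (\<Union>m. A m)"
      unfolding A_def using w j4 by (intro UN_I[of m] CollectI conjI exI[of _ j]) auto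
  qed
  show ?thesis
    using sub le AM by (intro bexI[of _ "\<Union>m. A m"]) auto
qed

end

section \<open>Exit from slabs under the annealed law\<close>

text \<open>The exit times form a closed set, so the infimum is attained and the path is outside the
  slab there. A negative component excludes the face at \<open>L > 0\<close> and leaves the one at
  \<open>- (\<beta> * L)\<close>.\<close>

lemma exit_backwards_below:
  assumes w: "continuous_on {0..} w" and exit: "w \<in> exit_backwards l \<beta> L" and L: "0 < L"
  shows "\<exists>t\<ge>0. w t \<bullet> l \<le> - (\<beta> * L)"
proof -
  define S where "S = {t. 0 \<le> t \<and> w t \<notin> slab l \<beta> L}"
  have fin: "Inf (ereal ` S) < \<infinity>" and neg: "w (real_of_ereal (Inf (ereal ` S))) \<bullet> l < 0"
    using exit by (auto simp: exit_backwards_def exit_time_def S_def)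
  have ne: "S \<noteq> {}"
    using fin by (auto simp: top_ereal_def)
  have bdd: "bdd_below S"
    by (rule bdd_belowI[of _ 0]) (simp add: S_def)
  have "closed S"
  proof -
    have "S = {0..} \<inter> w -` ({x. x \<bullet> l \<le> - \<beta> * L} \<union> {x. L \<le> x \<bullet> l})"
      by (auto simp: S_def slab_def not_less)
    moreover have "closed ({x. x \<bullet> l \<le> - \<beta> * L} \<union> {x. L \<le> x \<bullet> l})"
      by (intro closed_Un closed_Collect_le continuous_intros)
    ultimately show ?thesis
      by (simp only: continuous_closed_preimage[OF w closed_atLeast])
  qed
  then have mem: "Inf S \<in> S"
    using closed_contains_Inf[OF ne bdd] by simp
  have "Inf (ereal ` S) = ereal (Inf S)"
    using ereal_Inf'[OF bdd ne] by simp
  then have "w (Inf S) \<bullet> l < 0"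
    using neg by simp
  then have "w (Inf S) \<bullet> l \<le> - (\<beta> * L)" "0 \<le> Inf S"
    using mem L by (auto simp: S_def slab_def not_less)
  then show ?thesis by blast
qed

text \<open>The measure of a set under \<open>distr\<close> is either that of its preimage or the
  default 0; the bound covers both, so it applies to the exit event directly.\<close>

lemma emeasure_distr_le:
  assumes "f -` A \<inter> space M \<subseteq> E" "E \<in> sets M"
  shows "emeasure (distr M N f) A \<le> emeasure M E"
  unfolding distr_def emeasure_measure_of_conv using emeasure_mono[OF assms] by simp

text \<open>Nothing is assumed about the measurability of the kernel: where the annealed law is not
  given by the integral of the quenched laws, it vanishes.\<close>

lemma measure_annealed_law_le:
  assumes "prob_space P" "0 \<le> q"
    and le: "\<And>\<omega>. \<omega> \<in> space P \<Longrightarrow> emeasure (Q x \<omega>) (space path_space \<inter> A) \<le> ennreal q"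
  shows "measure (annealed_law P Q x) {z \<in> space (annealed_law P Q x). snd z \<in> A} \<le> q"
proof -
  interpret prob_space P by fact
  have sub: "sets (P \<Otimes>\<^sub>M path_space) \<subseteq> Pow (space P \<times> space path_space)"
    using sets.space_closed[of "P \<Otimes>\<^sub>M path_space"] by (simp add: space_pair_measure)
  have sp: "space (annealed_law P Q x) = space P \<times> space path_space"
    unfolding annealed_law_def using sub by (rule space_measure_of)
  let ?E = "{z \<in> space (annealed_law P Q x). snd z \<in> A}"
  have "emeasure (annealed_law P Q x) ?E \<le> (\<integral>\<^sup>+\<omega>. emeasure (Q x \<omega>) (Pair \<omega> -` ?E) \<partial>P)"
    unfolding annealed_law_def emeasure_measure_of_conv by simp
  also have "\<dots> \<le> (\<integral>\<^sup>+\<omega>. ennreal q \<partial>P)"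
  proof (rule nn_integral_mono)
    fix \<omega> assume \<omega>: "\<omega> \<in> space P"
    have "Pair \<omega> -` ?E = space path_space \<inter> A"
      using \<omega> by (auto simp: sp)
    then show "emeasure (Q x \<omega>) (Pair \<omega> -` ?E) \<le> ennreal q"
      using le[OF \<omega>] by simp
  qed
  also have "\<dots> = ennreal q"
    by (simp add: emeasure_space_1)
  finally show ?thesis
    using assms(2) by (simp add: measure_def enn2real_leI)
qed

lemma Limsup_elog_neg:
  assumes k: "0 < k" and p: "\<And>L. 0 < L \<Longrightarrow> 0 \<le> p L \<and> p L \<le> exp (- k * L)"
  shows "Limsup at_top (\<lambda>L. ereal (1 / L) * elog (p L)) < 0"
proof -
  have "\<forall>\<^sub>F L in at_top. ereal (1 / L) * elog (p L) \<le> ereal (- k)"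
    using eventually_gt_at_top[of 0]
  proof eventually_elim
    case (elim L)
    show ?case
    proof (cases "p L = 0")
      \<comment> \<open>Here \<open>elog\<close> is \<open>- \<infinity>\<close>, and the positive
        factor \<open>1 / L\<close> keeps it so.\<close>
      case True
      then show ?thesis using elim by (simp add: elog_def)
    next
      case False
      then have "0 < p L" using p[OF elim] by simp
      then have "ln (p L) \<le> - k * L"
        using p[OF elim] ln_le_cancel_iff[of "p L" "exp (- k * L)"] by simp
      then have "1 / L * ln (p L) \<le> 1 / L * (- k * L)"
        using elim by (intro mult_left_mono) auto
      then show ?thesis using False elim by (simp add: elog_def)
    qed
  qed
  then have "Limsup at_top (\<lambda>L. ereal (1 / L) * elog (p L)) \<le> ereal (- k)"
    by (rule Limsup_bounded)
  also have "\<dots> < 0" using k by simp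
  finally show ?thesis .
qed

text \<open>Every space carrying a solution gives the same bound, in which only
  \<open>\<nu>\<close>, \<open>\<delta>\<close>, \<open>\<beta>\<close> and \<open>L\<close> occur;
  hence it is uniform over environments.\<close>

lemma sde_law_exit_backwards:
  fixes c :: "real ^ 'n \<Rightarrow> real ^ 'n"
  assumes law: "sde_law a c 0 Q"
    and c: "continuous_on UNIV c" "\<And>y. \<delta> \<le> c y \<bullet> u"
    and a: "\<And>y. (norm (transpose (a y) *v u))\<^sup>2 \<le> \<nu>"
    and p: "0 < \<nu>" "0 < \<delta>" "0 < \<beta>" "0 < L"
  shows "emeasure Q (space path_space \<inter> exit_backwards u \<beta> L) \<le> ennreal (exp (- (\<delta> / \<nu> * \<beta> / 2) * L))"
proof -
  obtain M :: "((real \<Rightarrow> real ^ 'n) \<times> (real \<Rightarrow> real ^ 'n)) measure" and F B X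
    where sol: "sde_solution a c 0 M F B X"
      and Q: "Q = distr M path_space (\<lambda>w. \<lambda>t\<in>{0..}. X t w)"
    using law unfolding sde_law_def by (elim exE conjE)
  interpret drifting_sde a c 0 u M F B X \<nu> \<delta>
    using sol c a p(1,2) by (rule drifting_sde.intro)
  have "0 < \<beta> * L" using p by simp
  from emeasure_ever_below[OF refl this] obtain A where A: "A \<in> sets M"
    "{w \<in> space M. \<exists>t\<ge>0. X t w \<bullet> u \<le> - (\<beta> * L)} \<subseteq> A"
    "emeasure M A \<le> ennreal (exp (- \<gamma> * (\<beta> * L / 2)))"
    by (elim bexE conjE)
  have "(\<lambda>w. \<lambda>t\<in>{0..}. X t w) -` (space path_space \<inter> exit_backwards u \<beta> L) \<inter> space M
      \<subseteq> {w \<in> space M. \<exists>t\<ge>0. X t w \<bullet> u \<le> - (\<beta> * L)}"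
  proof
    fix w assume "w \<in> (\<lambda>w. \<lambda>t\<in>{0..}. X t w) -` (space path_space \<inter> exit_backwards u \<beta> L) \<inter> space M"
    then have w: "w \<in> space M" "(\<lambda>t\<in>{0..}. X t w) \<in> exit_backwards u \<beta> L" by auto
    have "continuous_on {0..} (\<lambda>t\<in>{0..}. X t w)"
      using X_continuous[OF w(1)] by (rule continuous_on_eq) simp
    from exit_backwards_below[OF this w(2) p(4)]
    obtain s where "0 \<le> s" "(\<lambda>t\<in>{0..}. X t w) s \<bullet> u \<le> - (\<beta> * L)"
      by (elim exE conjE)
    then show "w \<in> {w \<in> space M. \<exists>t\<ge>0. X t w \<bullet> u \<le> - (\<beta> * L)}"
      using w(1) by (intro CollectI conjI exI[of _ s]) simp_all
  qed
  then have "emeasure Q (space path_space \<inter> exit_backwards u \<beta> L) \<le> emeasure M A"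
    unfolding Q using A(1,2) by (intro emeasure_distr_le) (rule subset_trans)
  also note A(3)
  also have "- \<gamma> * (\<beta> * L / 2) = - (\<delta> / \<nu> * \<beta> / 2) * L"
    unfolding \<gamma>_def by simp
  finally show ?thesis .
qed

theorem proposition5p1:
  fixes P :: "'w measure"
    and t :: "real ^ 'n \<Rightarrow> 'w \<Rightarrow> 'w"
    and b :: "'w \<Rightarrow> real ^ 'n"
    and \<sigma> :: "'w \<Rightarrow> real ^ 'n ^ 'n"
    and b_bar \<sigma>_bar K \<nu> R \<delta> :: real
    and Q :: "real ^ 'n \<Rightarrow> 'w \<Rightarrow> (real \<Rightarrow> real ^ 'n) measure"
    and l :: "real ^ 'n"
  assumes "diffusion_in_random_environment P t b \<sigma> b_bar \<sigma>_bar K \<nu> R Q"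
    and "l \<in> sphere 0 1"
    and "\<delta> > 0"
    and "\<forall>\<omega>\<in>space P. \<forall>x. b (t x \<omega>) \<bullet> l > \<delta>"
  shows "condition_T P Q l"
proof -
  interpret diffusion_in_random_environment P t b \<sigma> b_bar \<sigma>_bar K \<nu> R Q by fact
  \<comment> \<open>Moving the direction by less than \<open>\<delta> / (2 * b_bar)\<close> changes
    the drift component by at most \<open>\<delta> / 2\<close>, because the drift is bounded by
    \<open>b_bar\<close>.\<close>
  define N where "N = ball l (\<delta> / (2 * b_bar))"
  define \<gamma>' where "\<gamma>' = (\<delta> / 2) / \<nu>"
  have shift: "t x \<omega> \<in> space P" if "\<omega> \<in> space P" for x \<omega>
  proof -
    have "(x, \<omega>) \<in> space (borel \<Otimes>\<^sub>M P)" using that by (simp add: space_pair_measure)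
    from measurable_space[OF shift_measurable this] show ?thesis by simp
  qed
  have quenched: "emeasure (Q 0 \<omega>) (space path_space \<inter> exit_backwards u \<beta> L) \<le> ennreal (exp (- (\<gamma>' * \<beta> / 2) * L))"
    if u: "u \<in> N" "norm u = 1" and \<beta>: "0 < \<beta>" and L: "0 < L" and \<omega>: "\<omega> \<in> space P" for u \<beta> L \<omega>
    unfolding \<gamma>'_def
  proof (rule sde_law_exit_backwards)
      show "sde_law (\<lambda>y. \<sigma> (t y \<omega>)) (\<lambda>y. b (t y \<omega>)) 0 (Q 0 \<omega>)"
        by (rule quenched_law[OF \<omega>])
      show "0 < \<nu>" "0 < \<delta> / 2" using constants_pos assms(3) by auto
      \<comment> \<open>Continuity of the drift makes the time integrals along paths exist and be
        additive.\<close>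
      have "K-lipschitz_on UNIV (\<lambda>y. b (t y \<omega>))"
      proof (rule lipschitz_onI)
        fix x y :: "real ^ 'n"
        show "dist (b (t x \<omega>)) (b (t y \<omega>)) \<le> K * dist x y"
          using lipschitz[OF \<omega>, of x y] norm_ge_zero[of "\<sigma> (t x \<omega>) - \<sigma> (t y \<omega>)"]
          unfolding dist_norm by linarith
      qed (use constants_pos in simp)
      then show "continuous_on UNIV (\<lambda>y. b (t y \<omega>))"
        by (rule lipschitz_on_continuous_on)
      show "(norm (transpose (\<sigma> (t y \<omega>)) *v u))\<^sup>2 \<le> \<nu>" for y
        using elliptic[OF \<omega>, where x = y and y = u] u(2) by simp
      show "\<delta> / 2 \<le> b (t y \<omega>) \<bullet> u" for y
      proof -
        have "\<bar>b (t y \<omega>) \<bullet> (l - u)\<bar> \<le> norm (b (t y \<omega>)) * norm (l - u)"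
          by (rule Cauchy_Schwarz_ineq2)
        also have "\<dots> \<le> b_bar * (\<delta> / (2 * b_bar))"
          using b_bounded[OF shift[OF \<omega>]] u(1) constants_pos
          by (intro mult_mono) (auto simp: N_def dist_norm)
        also have "\<dots> = \<delta> / 2"
          using constants_pos by simp
        finally have "b (t y \<omega>) \<bullet> l - b (t y \<omega>) \<bullet> u \<le> \<delta> / 2"
          unfolding inner_diff_right by linarith
        moreover have "\<delta> < b (t y \<omega>) \<bullet> l" using assms(4) \<omega> by blast
        ultimately show ?thesis by linarith
      qed
  qed (fact \<beta> L)+
  show ?thesis
    unfolding condition_T_def
  proof (intro exI[of _ N] conjI ballI allI impI)
    show "open N" by (simp add: N_def)
    show "l \<in> N" using assms(3) constants_pos by (simp add: N_def)
    fix u and \<beta> :: real assume u: "u \<in> N \<inter> sphere 0 1" and \<beta>: "0 < \<beta>"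
    show "Limsup at_top (\<lambda>L. ereal (1 / L) * elog (measure (annealed_law P Q 0)
               {z \<in> space (annealed_law P Q 0). snd z \<in> exit_backwards u \<beta> L})) < 0"
    proof (rule Limsup_elog_neg)
      show "0 < \<gamma>' * \<beta> / 2" using \<beta> assms(3) constants_pos by (simp add: \<gamma>'_def)
      fix L :: real assume L: "0 < L"
      show "0 \<le> measure (annealed_law P Q 0) {z \<in> space (annealed_law P Q 0). snd z \<in> exit_backwards u \<beta> L} \<and>
         measure (annealed_law P Q 0) {z \<in> space (annealed_law P Q 0). snd z \<in> exit_backwards u \<beta> L} \<le> exp (- (\<gamma>' * \<beta> / 2) * L)"
        using u \<beta> L by (intro conjI measure_nonneg measure_annealed_law_le quenched prob_space_axioms) auto
    qed
  qed
qed

end
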